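(* For every integer $h \ge 3$ there are constants $\varepsilon_0,\delta_0,C>0$ such that if $H$ is a graph on $h$ vertices and $0<\varepsilon \le \varepsilon_0$, then $$\mathrm{Rem}_H(\varepsilon) \le \big[S(\varepsilon^{C},\,\delta_0,\,\varepsilon)\big]^C .$$
   Context: All graphs are finite and simple. For vertex sets $A,B$ of a graph $G$, $e_G(A,B)$ is the number of ordered pairs $(u,v)\in A\times B$ with $uv\in E(G)$, and $d_G(A,B)=e_G(A,B)/(|A||B|)$. A pair $(A,B)$ is $\epsilon$-regular if $|d_G(A,B)-d_G(A',B')|\le \epsilon$ for all $A'\subseteq A$, $B'\subseteq B$ with $|A'|\ge\epsilon|A|$, $|B'|\ge\epsilon|B|$. An equipartition is a partition of $V(G)$ whose part sizes differ by at most $1$; its order is its number of parts. An equipartition $\{Z_1,\dots,Z_k\}$ is $\epsilon$-regular if all pairs $(Z_i,Z_j)$ but at most $\epsilon k^2$ are $\epsilon$-regular. The density of a graph $G=(V,E)$ is $d_G=2|E|/|V|^2$. For $\epsilon,\delta,p>0$, $S(\epsilon,\delta,p)$ denotes the smallest integer $S$ such that for every graph $G$ of density at least $p$ and every equipartition $\mathcal P_0$ of $V(G)$ of order at most $1/\epsilon$, one can add/remove at most $\delta|E(G)|$ edges so that the resulting graph has an $\epsilon$-regular equipartition that refines $\mathcal P_0$ and has order at most $S$. For a fixed graph $H$ on $h$ vertices, $\mathrm{Rem}_H(\varepsilon)$ denotes the smallest value $R$ such that every $n$-vertex graph $G$ from which one must remove at least $\varepsilon n^2$ edges in order to make it $H$-free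 contains at least $n^h/R$ copies of $H$. *)

theory Defs
  imports Complex_Main "HOL-Library.FuncSet" "HOL-Library.Disjoint_Sets"
begin

definition simple_graph :: "nat set \<Rightarrow> nat set set \<Rightarrow> bool" where
  "simple_graph V E \<longleftrightarrow> finite V \<and> E \<subseteq> {{u, v} | u v. u \<in> V \<and> v \<in> V \<and> u \<noteq> v}"

definition edge_count :: "nat set set \<Rightarrow> nat set \<Rightarrow> nat set \<Rightarrow> nat" where
  "edge_count E A B = card {(u, v). u \<in> A \<and> v \<in> B \<and> {u, v} \<in> E}"

definition pair_density :: "nat set set \<Rightarrow> nat set \<Rightarrow> nat set \<Rightarrow> real" where
  "pair_density E A B = real (edge_count E A B) / (real (card A) * real (card B))"

definition regular_pair :: "real \<Rightarrow> nat set set \<Rightarrow> nat set \<Rightarrow> nat set \<Rightarrow> bool" where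
  "regular_pair eps E A B \<longleftrightarrow>
     (\<forall>A' \<subseteq> A. \<forall>B' \<subseteq> B. real (card A') \<ge> eps * real (card A) \<and> real (card B') \<ge> eps * real (card B)
        \<longrightarrow> \<bar>pair_density E A B - pair_density E A' B'\<bar> \<le> eps)"

definition equipartition :: "nat set \<Rightarrow> nat set set \<Rightarrow> bool" where
  "equipartition V P \<longleftrightarrow> partition_on V P \<and> (\<forall>Z1\<in>P. \<forall>Z2\<in>P. card Z1 \<le> card Z2 + 1)"

definition regular_equipartition :: "real \<Rightarrow> nat set \<Rightarrow> nat set set \<Rightarrow> nat set set \<Rightarrow> bool" where
  "regular_equipartition eps V E P \<longleftrightarrow> equipartition V P \<and>
     real (card {{A, B} | A B. A \<in> P \<and> B \<in> P \<and> A \<noteq> B \<and> \<not> regular_pair eps E A B})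
       \<le> eps * real (card P) ^ 2"

definition refines :: "nat set set \<Rightarrow> nat set set \<Rightarrow> bool" where
  "refines P Q \<longleftrightarrow> (\<forall>Z\<in>P. \<exists>W\<in>Q. Z \<subseteq> W)"

definition graph_density :: "nat set \<Rightarrow> nat set set \<Rightarrow> real" where
  "graph_density V E = 2 * real (card E) / real (card V) ^ 2"

definition S_reg :: "real \<Rightarrow> real \<Rightarrow> real \<Rightarrow> nat" where
  "S_reg eps delta p = (LEAST S :: nat. \<forall>V E P0.
      simple_graph V E \<and> graph_density V E \<ge> p \<and> equipartition V P0 \<and> real (card P0) \<le> 1 / eps \<longrightarrow>
      (\<exists>E'. simple_graph V E' \<and> real (card ((E - E') \<union> (E' - E))) \<le> delta * real (card E) \<and>
         (\<exists>P. regular_equipartition eps V E' P \<and> refines P P0 \<and> card P \<le> S)))"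

definition copies :: "nat set \<Rightarrow> nat set set \<Rightarrow> nat set \<Rightarrow> nat set set \<Rightarrow> nat" where
  "copies VH EH V E = card {f \<in> VH \<rightarrow>\<^sub>E V. inj_on f VH \<and>
      (\<forall>u\<in>VH. \<forall>v\<in>VH. {u, v} \<in> EH \<longrightarrow> {f u, f v} \<in> E)}"

definition Rem :: "nat set \<Rightarrow> nat set set \<Rightarrow> real \<Rightarrow> real" where
  "Rem VH EH eps = Inf {R :: real. R > 0 \<and> (\<forall>V E.
      simple_graph V E \<and> (\<forall>F \<subseteq> E. copies VH EH V (E - F) = 0 \<longrightarrow> real (card F) \<ge> eps * real (card V) ^ 2)
      \<longrightarrow> real (copies VH EH V E) \<ge> real (card V) ^ card VH / R)}"

end

theory Submission
  imports Defs
begin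

text \<open>
  If \<open>G\<close> is \<open>\<epsilon>\<close>-far from being \<open>H\<close>-free, the union \<open>E\<^sub>1\<close> of a maximal family of edge-disjoint copies
  of \<open>H\<close> has at least \<open>\<epsilon>n\<^sup>2\<close> edges, and it stays non-\<open>H\<close>-free after deleting fewer than \<open>|E\<^sub>1|/e(H)\<close> edges.
  Hence editing a small constant fraction of \<open>E\<^sub>1\<close>, as \<open>S_reg\<close> permits, is harmless, although the
  same fraction of \<open>E(G)\<close> need not be. In the edited graph \<open>E'\<close> one discards the edges of \<open>E\<^sub>1\<close> that
  were lost, lie inside a part, or lie in an irregular pair, a sparse pair, or a pair with a large
  relative share of edges of \<open>E' - E\<^sub>1\<close>; a copy of \<open>H\<close> survives. Its parts carry many copies of
  \<open>H\<close> in \<open>E'\<close>, and only a small proportion of these use an edge outside \<open>E\<^sub>1\<close>, because the counting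
  lemma tolerates one arbitrary pair when all others are regular.
  Finally \<open>S \<ge> (1/\<epsilon>)\<^bsup>C-1\<^esup>\<close>, since the initial partition may have that many parts, so all
  polynomial losses in \<open>\<epsilon>\<close> are absorbed by powers of \<open>S\<close>.
\<close>

text \<open>Editing may add edges that are not in G, so copies of H in \<open>E'\<close> prove
  nothing by themselves. The share of added edges is measured against the density of each pair, not
  against 1; therefore the tolerated share 1/(4M) depends on h alone, and so does the edit fraction.
  Here \<open>M = h\<^sup>2\<close> bounds the number of edges of H. Each of the five kinds of
  discarded edges has a budget of card E1 / (8M), below card E1 / M in total. Pairs with too many
  added edges contain at most 2 * delta * card E1 * 4M edges, and equating this with the budget
  gives delta = 1/(64 M^2).

  The exponent 2M+3 comes from the counting: the pairs kept have density at least gamma = eps/(8M)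
  >= eps^2, so the main term may be as small as gamma^M >= eps^(2M), and the regularity error,
  multiplied by a constant times M^2, has to stay below it; three further factors eps pay for that.

  Szemeredi's regularity lemma is proved because a \<open>LEAST\<close> says nothing unless some
  bound exists. Its tower-type size never enters the estimate.\<close>

section \<open>The regularity lemma\<close>

lemma partition_on_card:
  assumes "partition_on A P" "finite A"
  shows "card A = (\<Sum>C\<in>P. card C)"
  using sum.partition[OF assms(2,1), of "\<lambda>_. 1::nat"] by simp

lemma partition_on_finite_part:
  assumes "partition_on A P" "finite A" "C \<in> P"
  shows "finite C" "C \<subseteq> A" "C \<noteq> {}" "card C > 0"
proof -
  show s: "C \<subseteq> A" using assms partition_onD1 by blast
  then show f: "finite C" using assms(2) finite_subset by blast
  show n: "C \<noteq> {}" using assms partition_onD3 by blast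
  show "card C > 0" using f n by (simp add: card_gt_0_iff)
qed

lemma edge_count_sum:
  assumes "finite A" "finite B"
  shows "real (edge_count E A B) = (\<Sum>x\<in>A. \<Sum>y\<in>B. of_bool ({x, y} \<in> E))"
proof -
  have "{(u, v). u \<in> A \<and> v \<in> B \<and> {u, v} \<in> E} = {z \<in> A \<times> B. {fst z, snd z} \<in> E}"
    by auto
  then have "real (edge_count E A B) = (\<Sum>z\<in>A\<times>B. of_bool ({fst z, snd z} \<in> E))"
    using assms by (simp add: edge_count_def sum.If_cases of_bool_def Int_def)
  also have "\<dots> = (\<Sum>x\<in>A. \<Sum>y\<in>B. of_bool ({x, y} \<in> E))"
    by (simp add: sum.cartesian_product case_prod_beta)
  finally show ?thesis .
qed

lemma edge_count_commute: "edge_count E A B = edge_count E B A"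
proof -
  have "bij_betw prod.swap {(u, v). u \<in> A \<and> v \<in> B \<and> {u, v} \<in> E}
      {(u, v). u \<in> B \<and> v \<in> A \<and> {u, v} \<in> E}"
    by (rule bij_betwI[of _ _ _ prod.swap]) (auto simp: insert_commute)
  then show ?thesis
    unfolding edge_count_def by (rule bij_betw_same_card)
qed

lemma finite_edge_pairs:
  assumes "finite A" "finite B"
  shows "finite {(u, v). u \<in> A \<and> v \<in> B \<and> {u, v} \<in> E}"
  by (rule finite_subset[of _ "A \<times> B"]) (use assms in auto)

lemma edge_count_mono:
  assumes "finite A" "finite B" "A' \<subseteq> A" "B' \<subseteq> B"
  shows "edge_count E A' B' \<le> edge_count E A B"
  unfolding edge_count_def
  by (rule card_mono[OF finite_edge_pairs]) (use assms in auto)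

lemma edge_count_le:
  assumes "finite A" "finite B"
  shows "edge_count E A B \<le> card A * card B"
proof -
  have "edge_count E A B \<le> card (A \<times> B)"
    unfolding edge_count_def by (rule card_mono) (use assms in auto)
  then show ?thesis by (simp add: card_cartesian_product)
qed

lemma edge_count_partition:
  assumes "partition_on A P" "finite A" "partition_on B Q" "finite B"
  shows "real (edge_count E A B) = (\<Sum>C\<in>P. \<Sum>D\<in>Q. real (edge_count E C D))"
proof -
  have "real (edge_count E A B) = (\<Sum>C\<in>P. \<Sum>x\<in>C. \<Sum>D\<in>Q. \<Sum>y\<in>D. of_bool ({x, y} \<in> E))"
    unfolding edge_count_sum[OF assms(2,4)] sum.partition[OF assms(2,1)]
      sum.partition[OF assms(4,3)] ..
  also have "\<dots> = (\<Sum>C\<in>P. \<Sum>D\<in>Q. \<Sum>x\<in>C. \<Sum>y\<in>D. of_bool ({x, y} \<in> E))"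
    by (intro sum.cong refl sum.swap)
  also have "\<dots> = (\<Sum>C\<in>P. \<Sum>D\<in>Q. real (edge_count E C D))"
    using assms by (intro sum.cong refl edge_count_sum[symmetric]) (auto intro: partition_on_finite_part)
  finally show ?thesis .
qed

lemma edge_count_eq_density:
  assumes "card A > 0" "card B > 0"
  shows "real (edge_count E A B) = pair_density E A B * (real (card A) * real (card B))"
  using assms by (simp add: pair_density_def)

lemma pair_density_bounds:
  assumes "finite A" "finite B"
  shows "0 \<le> pair_density E A B" "pair_density E A B \<le> 1"
proof -
  show "0 \<le> pair_density E A B" by (simp add: pair_density_def)
  have "real (edge_count E A B) \<le> real (card A) * real (card B)"
    using edge_count_le[OF assms, of E] by (metis of_nat_le_iff of_nat_mult)
  then show "pair_density E A B \<le> 1"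
    unfolding pair_density_def by (intro divide_le_eq_1[THEN iffD2]) (auto simp: zero_less_mult_iff zero_le_mult_iff)
qed

text \<open>Greedy: cut off label-constant parts while some label class has more than \<open>q\<close> elements;
  once none is left, at most \<open>card L * q\<close> elements remain.\<close>

lemma equitable_split:
  fixes lab :: "'a \<Rightarrow> 'b"
  assumes "finite L" "q > 0"
  shows "finite A \<Longrightarrow> lab ` A \<subseteq> L \<Longrightarrow> q * t \<le> card A \<Longrightarrow> card A \<le> (q + 1) * t \<Longrightarrow>
    \<exists>Q. partition_on A Q \<and> card Q = t \<and> (\<forall>Z\<in>Q. card Z = q \<or> card Z = q + 1) \<and>
      card (\<Union>{Z \<in> Q. \<not> (\<forall>x\<in>Z. \<forall>y\<in>Z. lab x = lab y)}) \<le> card L * (q + 1)"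
proof (induction t arbitrary: A)
  case 0
  then have "A = {}" by simp
  then show ?case by (intro exI[of _ "{}"]) (auto simp: partition_on_def)
next
  case (Suc t)
  \<comment> \<open>The part cut off gets size \<open>q + 1\<close> exactly when
    \<open>card A\<close> exceeds \<open>q * Suc t\<close>; either way the rest satisfies both size
    bounds with \<open>t\<close> in place of \<open>Suc t\<close>.\<close>
  define s where "s = (if card A \<ge> q * Suc t + 1 then q + 1 else q)"
  have s: "s = q \<or> s = q + 1" "s \<le> q + 1" "s > 0" "s \<le> card A"
    using assms Suc.prems by (auto simp: s_def)
  have rem: "q * t \<le> card A - s" "card A - s \<le> (q + 1) * t"
    using Suc.prems by (auto simp: s_def)
  \<comment> \<open>The induction hypothesis depends on \<open>B\<close> only through its size, so
    any \<open>B\<close> of size \<open>s\<close> may be cut off. A label-constant \<open>B\<close>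
    also carries the label bound over; for other \<open>B\<close> the trivial bound by
    \<open>A\<close> remains.\<close>
  have ext: "\<exists>Q. partition_on A Q \<and> card Q = Suc t \<and> (\<forall>Z\<in>Q. card Z = q \<or> card Z = q + 1) \<and>
      (\<Union>{Z \<in> Q. \<not> (\<forall>x\<in>Z. \<forall>y\<in>Z. lab x = lab y)}) \<subseteq> A \<and>
      ((\<forall>x\<in>B. \<forall>y\<in>B. lab x = lab y) \<longrightarrow>
        card (\<Union>{Z \<in> Q. \<not> (\<forall>x\<in>Z. \<forall>y\<in>Z. lab x = lab y)}) \<le> card L * (q + 1))"
    if B: "B \<subseteq> A" "card B = s" for B
  proof -
    have fB: "finite B" using B Suc.prems finite_subset by blast
    have cB: "card (A - B) = card A - s"
      using B fB by (simp add: card_Diff_subset)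
    obtain Q where Q: "partition_on (A - B) Q" "card Q = t" "\<forall>Z\<in>Q. card Z = q \<or> card Z = q + 1"
      "card (\<Union>{Z \<in> Q. \<not> (\<forall>x\<in>Z. \<forall>y\<in>Z. lab x = lab y)}) \<le> card L * (q + 1)"
      using Suc.IH[of "A - B"] Suc.prems cB rem by auto
    have ne: "B \<noteq> {}" using B s by auto
    have BQ: "B \<notin> Q" using partition_onD1[OF Q(1)] ne by auto
    have fQ: "finite Q" using Q(1) Suc.prems(1) finite_elements by blast
    have p: "partition_on A (insert B Q)"
      using Q(1) B ne partition_onD1[OF Q(1)] by (subst partition_on_insert) (auto simp: disjnt_def)
    show ?thesis
    proof (intro exI[of _ "insert B Q"] conjI impI)
      show "card (insert B Q) = Suc t" using Q(2) BQ fQ by simp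
      show "\<forall>Z\<in>insert B Q. card Z = q \<or> card Z = q + 1" using Q(3) B(2) s(1) by simp
      show "\<Union>{Z \<in> insert B Q. \<not> (\<forall>x\<in>Z. \<forall>y\<in>Z. lab x = lab y)} \<subseteq> A"
        using partition_onD1[OF p] by blast
      assume "\<forall>x\<in>B. \<forall>y\<in>B. lab x = lab y"
      then have "{Z \<in> insert B Q. \<not> (\<forall>x\<in>Z. \<forall>y\<in>Z. lab x = lab y)} =
          {Z \<in> Q. \<not> (\<forall>x\<in>Z. \<forall>y\<in>Z. lab x = lab y)}"
        by blast
      then show "card (\<Union>{Z \<in> insert B Q. \<not> (\<forall>x\<in>Z. \<forall>y\<in>Z. lab x = lab y)}) \<le> card L * (q + 1)"
        using Q(4) by simp
    qed (fact p)
  qed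
  show ?case
  proof (cases "\<exists>l\<in>L. card {x \<in> A. lab x = l} \<ge> q + 1")
    case True
    then obtain l where "card {x \<in> A. lab x = l} \<ge> q + 1" by blast
    then obtain B where B: "B \<subseteq> {x \<in> A. lab x = l}" "card B = s"
      by (meson obtain_subset_with_card_n s(2) le_trans)
    then have "\<forall>x\<in>B. \<forall>y\<in>B. lab x = lab y" by auto
    moreover have "B \<subseteq> A" using B by auto
    ultimately show ?thesis using ext[OF _ B(2)] by meson
  next
    \<comment> \<open>All label classes are small, hence so is \<open>A\<close> itself, and the
      bound holds whatever the parts look like.\<close>
    case False
    have "A = (\<Union>l\<in>L. {x \<in> A. lab x = l})" using Suc.prems by auto
    then have "card A \<le> (\<Sum>l\<in>L. card {x \<in> A. lab x = l})"
      using card_UN_le[OF assms(1)] by metis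
    also have "\<dots> \<le> (\<Sum>l\<in>L. q + 1)"
      using False by (intro sum_mono) (meson nat_le_linear)
    finally have cA: "card A \<le> card L * (q + 1)" by simp
    obtain B where B: "B \<subseteq> A" "card B = s"
      by (meson obtain_subset_with_card_n s(4))
    obtain Q where Q: "partition_on A Q" "card Q = Suc t" "\<forall>Z\<in>Q. card Z = q \<or> card Z = q + 1"
      "(\<Union>{Z \<in> Q. \<not> (\<forall>x\<in>Z. \<forall>y\<in>Z. lab x = lab y)}) \<subseteq> A"
      using ext[OF B] by blast
    have "card (\<Union>{Z \<in> Q. \<not> (\<forall>x\<in>Z. \<forall>y\<in>Z. lab x = lab y)}) \<le> card A"
      using Q(4) Suc.prems(1) by (rule card_mono[rotated])
    then show ?thesis using Q cA by (intro exI[of _ Q]) auto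
  qed
qed

section \<open>Energy of a partition and its increment under refinement\<close>

definition energy :: "nat set set \<Rightarrow> nat set set \<Rightarrow> real" where
  "energy E P = (\<Sum>A\<in>P. \<Sum>B\<in>P. real (card A) * real (card B) * (pair_density E A B)\<^sup>2)"

lemma sum_card_product:
  assumes "partition_on A P" "finite A" "partition_on B Q" "finite B"
  shows "(\<Sum>C\<in>P. \<Sum>D\<in>Q. real (card C) * real (card D)) = real (card A) * real (card B)"
proof -
  have "(\<Sum>C\<in>P. \<Sum>D\<in>Q. real (card C) * real (card D)) = (\<Sum>C\<in>P. real (card C)) * (\<Sum>D\<in>Q. real (card D))"
    by (simp add: sum_product)
  then show ?thesis
    using partition_on_card[OF assms(1,2)] partition_on_card[OF assms(3,4)] by simp
qed

text \<open>The energy is not divided by the square of \<open>card V\<close>; this ceiling is what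
  limits the number of increments.\<close>

lemma energy_le:
  assumes "partition_on V P" "finite V"
  shows "energy E P \<le> (real (card V))\<^sup>2"
proof -
  have "energy E P \<le> (\<Sum>A\<in>P. \<Sum>B\<in>P. real (card A) * real (card B))"
    unfolding energy_def
  proof (intro sum_mono)
    fix A B assume "A \<in> P" "B \<in> P"
    then have f: "finite A" "finite B" using assms by (auto intro: partition_on_finite_part)
    have "(pair_density E A B)\<^sup>2 \<le> 1"
      using pair_density_bounds[OF f, of E] by (simp add: power_le_one)
    then show "real (card A) * real (card B) * (pair_density E A B)\<^sup>2 \<le> real (card A) * real (card B)"
      by (simp add: mult_left_le)
  qed
  then show ?thesis using sum_card_product[OF assms assms] by (simp add: power2_eq_square)
qed

lemma energy_nonneg: "energy E P \<ge> 0"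
  unfolding energy_def by (intro sum_nonneg) auto

text \<open>The identity "second moment = squared mean + variance": with weights |C||D|, the mean of
  the densities of the subpairs is \<open>d\<close>.\<close>

lemma energy_defect:
  fixes E :: "nat set set"
  assumes "partition_on A P" "finite A" "partition_on B Q" "finite B"
    and "card A > 0" "card B > 0"
  defines "d \<equiv> pair_density E A B"
  shows "(\<Sum>C\<in>P. \<Sum>D\<in>Q. real (card C) * real (card D) * (pair_density E C D)\<^sup>2) =
    real (card A) * real (card B) * d\<^sup>2 +
    (\<Sum>C\<in>P. \<Sum>D\<in>Q. real (card C) * real (card D) * (pair_density E C D - d)\<^sup>2)"
proof -
  have e: "(\<Sum>C\<in>P. \<Sum>D\<in>Q. real (card C) * real (card D) * pair_density E C D) = d * (real (card A) * real (card B))"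
  proof -
    have "(\<Sum>C\<in>P. \<Sum>D\<in>Q. real (card C) * real (card D) * pair_density E C D) = real (edge_count E A B)"
      unfolding edge_count_partition[OF assms(1-4)]
    proof (intro sum.cong refl)
      fix C D assume "C \<in> P" "D \<in> Q"
      then have "card C > 0" "card D > 0" using assms(1-4) by (auto intro: partition_on_finite_part)
      then show "real (card C) * real (card D) * pair_density E C D = real (edge_count E C D)"
        by (simp add: edge_count_eq_density)
    qed
    also have "\<dots> = d * (real (card A) * real (card B))"
      unfolding d_def by (rule edge_count_eq_density) fact+
    finally show ?thesis .
  qed
  have "(\<Sum>C\<in>P. \<Sum>D\<in>Q. real (card C) * real (card D) * (pair_density E C D - d)\<^sup>2) =
     (\<Sum>C\<in>P. \<Sum>D\<in>Q. real (card C) * real (card D) * (pair_density E C D)\<^sup>2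
        - 2 * d * (real (card C) * real (card D) * pair_density E C D)
        + d\<^sup>2 * (real (card C) * real (card D)))"
    by (intro sum.cong refl) (simp add: power2_eq_square algebra_simps)
  also have "\<dots> = (\<Sum>C\<in>P. \<Sum>D\<in>Q. real (card C) * real (card D) * (pair_density E C D)\<^sup>2)
        - 2 * d * (\<Sum>C\<in>P. \<Sum>D\<in>Q. real (card C) * real (card D) * pair_density E C D)
        + d\<^sup>2 * (\<Sum>C\<in>P. \<Sum>D\<in>Q. real (card C) * real (card D))"
    by (simp add: sum.distrib sum_subtractf sum_distrib_left)
  also have "\<dots> = (\<Sum>C\<in>P. \<Sum>D\<in>Q. real (card C) * real (card D) * (pair_density E C D)\<^sup>2)
        - real (card A) * real (card B) * d\<^sup>2"
    unfolding e sum_card_product[OF assms(1-4)] by (simp add: power2_eq_square algebra_simps)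
  finally show ?thesis by simp
qed

text \<open>The Cauchy--Schwarz step, in the form \<open>x\<^sup>2 \<ge> 2\<mu>x - \<mu>\<^sup>2\<close> with \<open>\<mu>\<close> the normalised discrepancy.\<close>

lemma energy_defect_ge:
  assumes "partition_on A P" "finite A" "partition_on B Q" "finite B"
    and "card A > 0" "card B > 0" and "S \<subseteq> P" "T \<subseteq> Q"
  shows "(\<Sum>C\<in>P. \<Sum>D\<in>Q. real (card C) * real (card D) * (pair_density E C D - d)\<^sup>2) * (real (card A) * real (card B))
    \<ge> (real (edge_count E (\<Union>S) (\<Union>T)) - d * (real (card (\<Union>S)) * real (card (\<Union>T))))\<^sup>2"
proof -
  have pS: "partition_on (\<Union>S) S" "partition_on (\<Union>T) T"
    using assms by (auto simp: partition_on_def disjoint_def) blast+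
  have sub: "\<Union>S \<subseteq> A" "\<Union>T \<subseteq> B"
    using assms partition_onD1 by blast+
  have fS: "finite (\<Union>S)" "finite (\<Union>T)" using sub assms finite_subset by blast+
  have fP: "finite P" "finite Q" using assms finite_elements by blast+
  define X where "X = real (edge_count E (\<Union>S) (\<Union>T)) - d * (real (card (\<Union>S)) * real (card (\<Union>T)))"
  define W where "W = real (card A) * real (card B)"
  have W: "W > 0" using assms by (simp add: W_def)
  \<comment> \<open>The maximiser of 2 \<mu> X - \<mu>^2 W, where this expression takes the value
    X^2 / W.\<close>
  define \<mu> where "\<mu> = X / W"
  have X: "X = (\<Sum>C\<in>S. \<Sum>D\<in>T. real (card C) * real (card D) * (pair_density E C D - d))"
  proof -
    have "X = (\<Sum>C\<in>S. \<Sum>D\<in>T. real (edge_count E C D)) - d * (\<Sum>C\<in>S. \<Sum>D\<in>T. real (card C) * real (card D))"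
      unfolding X_def edge_count_partition[OF pS(1) fS(1) pS(2) fS(2)]
        sum_card_product[OF pS(1) fS(1) pS(2) fS(2)] ..
    also have "\<dots> = (\<Sum>C\<in>S. \<Sum>D\<in>T. real (edge_count E C D) - d * (real (card C) * real (card D)))"
      by (simp add: sum_subtractf sum_distrib_left)
    also have "\<dots> = (\<Sum>C\<in>S. \<Sum>D\<in>T. real (card C) * real (card D) * (pair_density E C D - d))"
    proof (intro sum.cong refl)
      fix C D assume "C \<in> S" "D \<in> T"
      then have "card C > 0" "card D > 0" using pS fS by (auto intro: partition_on_finite_part)
      then show "real (edge_count E C D) - d * (real (card C) * real (card D)) =
          real (card C) * real (card D) * (pair_density E C D - d)"
        by (simp add: edge_count_eq_density algebra_simps)
    qed
    finally show ?thesis .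
  qed
  have WST: "real (card (\<Union>S)) * real (card (\<Union>T)) \<le> W"
    unfolding W_def using sub assms by (intro mult_mono) (auto intro: card_mono)
  have "2 * \<mu> * X - \<mu>\<^sup>2 * W \<le> 2 * \<mu> * X - \<mu>\<^sup>2 * (real (card (\<Union>S)) * real (card (\<Union>T)))"
    using WST by (simp add: mult_left_mono)
  also have "\<dots> = (\<Sum>C\<in>S. \<Sum>D\<in>T. 2 * \<mu> * (real (card C) * real (card D) * (pair_density E C D - d))
      - \<mu>\<^sup>2 * (real (card C) * real (card D)))"
    unfolding X sum_card_product[OF pS(1) fS(1) pS(2) fS(2), symmetric]
    by (simp add: sum_subtractf sum_distrib_left)
  also have "\<dots> \<le> (\<Sum>C\<in>S. \<Sum>D\<in>T. real (card C) * real (card D) * (pair_density E C D - d)\<^sup>2)"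
  proof (intro sum_mono)
    fix C D
    have "0 \<le> (real (card C) * real (card D)) * (pair_density E C D - d - \<mu>)\<^sup>2" by simp
    then show "2 * \<mu> * (real (card C) * real (card D) * (pair_density E C D - d))
      - \<mu>\<^sup>2 * (real (card C) * real (card D)) \<le> real (card C) * real (card D) * (pair_density E C D - d)\<^sup>2"
      by (simp add: power2_eq_square algebra_simps)
  qed
  also have "\<dots> \<le> (\<Sum>C\<in>S. \<Sum>D\<in>Q. real (card C) * real (card D) * (pair_density E C D - d)\<^sup>2)"
    using assms fP by (intro sum_mono sum_mono2) auto
  also have "\<dots> \<le> (\<Sum>C\<in>P. \<Sum>D\<in>Q. real (card C) * real (card D) * (pair_density E C D - d)\<^sup>2)"
    using assms fP by (intro sum_mono2) (auto intro!: sum_nonneg)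
  finally have "(2 * \<mu> * X - \<mu>\<^sup>2 * W) * W \<le>
     (\<Sum>C\<in>P. \<Sum>D\<in>Q. real (card C) * real (card D) * (pair_density E C D - d)\<^sup>2) * W"
    using W by (intro mult_right_mono) auto
  moreover have "(2 * \<mu> * X - \<mu>\<^sup>2 * W) * W = X\<^sup>2"
    using W by (simp add: \<mu>_def power2_eq_square field_simps)
  ultimately show ?thesis by (simp add: X_def W_def)
qed

text \<open>Moves the discrepancy from a witness \<open>A'\<close>, \<open>B'\<close> to sets
  \<open>A''\<close>, \<open>B''\<close> that can be unions of parts. The witness has discrepancy at
  least eps * |A'||B'| >= eps^3 |A||B|; shaving eps^3/4 off each side costs at most half of
  that.\<close>

lemma irregular_discrepancy:
  assumes fin: "finite A" "finite B" and ne: "card A > 0" "card B > 0" and "eps > 0"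
    and sub: "A' \<subseteq> A" "B' \<subseteq> B" "A'' \<subseteq> A'" "B'' \<subseteq> B'"
    and big: "real (card A') \<ge> eps * real (card A)" "real (card B') \<ge> eps * real (card B)"
    and irr: "\<bar>pair_density E A B - pair_density E A' B'\<bar> > eps"
    and close: "real (card (A' - A'')) \<le> eps ^ 3 / 4 * real (card A)"
       "real (card (B' - B'')) \<le> eps ^ 3 / 4 * real (card B)"
  shows "\<bar>real (edge_count E A'' B'') - pair_density E A B * (real (card A'') * real (card B''))\<bar>
     \<ge> eps ^ 3 / 2 * (real (card A) * real (card B))"
proof -
  define d where "d = pair_density E A B"
  define a b where "a = real (card A)" and "b = real (card B)"
  define a' b' where "a' = real (card A')" and "b' = real (card B')"
  define a'' b'' where "a'' = real (card A'')" and "b'' = real (card B'')"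
  have fin': "finite A'" "finite B'" "finite A''" "finite B''"
    using fin sub by (meson finite_subset)+
  have d: "0 \<le> d" "d \<le> 1" unfolding d_def using pair_density_bounds[OF fin] by auto
  have pos: "a > 0" "b > 0" using ne by (auto simp: a_def b_def)
  have a': "a' \<ge> eps * a" "b' \<ge> eps * b" "a' \<le> a" "b' \<le> b"
    using big fin sub by (auto simp: a_def b_def a'_def b'_def intro: card_mono)
  have pos': "a' > 0" "b' > 0" using a' pos \<open>eps > 0\<close> by (smt (verit) mult_pos_pos)+
  have a'': "a'' \<le> a'" "b'' \<le> b'" "0 \<le> a''" "0 \<le> b''"
    using fin' sub by (auto simp: a''_def b''_def a'_def b'_def intro: card_mono)
  have cl: "a' - a'' \<le> eps ^ 3 / 4 * a" "b' - b'' \<le> eps ^ 3 / 4 * b"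
    using close fin' sub by (auto simp: a_def b_def a''_def b''_def a'_def b'_def card_Diff_subset of_nat_diff card_mono)
  have prod_diff: "a' * b' - a'' * b'' \<le> eps ^ 3 / 2 * (a * b)"
  proof -
    have "a' * b' - a'' * b'' = (a' - a'') * b' + a'' * (b' - b'')" by (simp add: algebra_simps)
    also have "\<dots> \<le> (eps ^ 3 / 4 * a) * b + a * (eps ^ 3 / 4 * b)"
      using cl a' a'' pos \<open>eps > 0\<close> by (intro add_mono mult_mono) auto
    finally show ?thesis by (simp add: algebra_simps)
  qed
  have e': "real (edge_count E A' B') = pair_density E A' B' * (a' * b')"
    unfolding a'_def b'_def by (rule edge_count_eq_density) (use pos' in \<open>auto simp: a'_def b'_def\<close>)
  have big1: "\<bar>real (edge_count E A' B') - d * (a' * b')\<bar> \<ge> eps ^ 3 * (a * b)"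
  proof -
    have "eps ^ 3 * (a * b) = eps * ((eps * a) * (eps * b))"
      by (simp add: power3_eq_cube algebra_simps)
    also have "\<dots> \<le> eps * (a' * b')"
      using a' pos pos' \<open>eps > 0\<close> by (intro mult_left_mono mult_mono) auto
    also have "\<dots> \<le> \<bar>d - pair_density E A' B'\<bar> * (a' * b')"
      using irr pos' by (intro mult_right_mono) (auto simp: d_def)
    also have "\<dots> = \<bar>(d - pair_density E A' B') * (a' * b')\<bar>"
      using pos' by (simp add: abs_mult)
    also have "\<dots> = \<bar>real (edge_count E A' B') - d * (a' * b')\<bar>"
      unfolding e' by (subst abs_minus_commute) (simp add: algebra_simps)
    finally show ?thesis .
  qed
  have ed: "real (edge_count E A'' B'') \<le> real (edge_count E A' B')"
    using fin' sub edge_count_mono by simp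
  have "real (edge_count E A' B') - real (edge_count E A'' B'') \<le> a' * b' - a'' * b''"
  proof -
    let ?K = "\<lambda>A B. {(u, v). u \<in> A \<and> v \<in> B \<and> {u, v} \<in> E}"
    have "edge_count E A' B' - edge_count E A'' B'' = card (?K A' B' - ?K A'' B'')"
      unfolding edge_count_def
      by (rule card_Diff_subset[symmetric]) (use fin' sub in \<open>auto intro: finite_edge_pairs\<close>)
    also have "\<dots> \<le> card (A' \<times> B' - A'' \<times> B'')"
      by (rule card_mono) (use fin' in auto)
    also have "\<dots> = card A' * card B' - card A'' * card B''"
      using fin' sub by (subst card_Diff_subset) (auto simp: card_cartesian_product)
    finally have "edge_count E A' B' - edge_count E A'' B'' \<le> card A' * card B' - card A'' * card B''" .
    moreover have "card A'' * card B'' \<le> card A' * card B'"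
      using fin' sub by (intro mult_mono) (auto intro: card_mono)
    ultimately have "edge_count E A' B' + card A'' * card B'' \<le> edge_count E A'' B'' + card A' * card B'"
      by linarith
    then have "real (edge_count E A' B' + card A'' * card B'') \<le> real (edge_count E A'' B'' + card A' * card B')"
      by (rule of_nat_mono)
    then show ?thesis by (simp add: a'_def b'_def a''_def b''_def)
  qed
  moreover have "0 \<le> d * (a' * b' - a'' * b'')" "d * (a' * b' - a'' * b'') \<le> a' * b' - a'' * b''"
  proof -
    have "a'' * b'' \<le> a' * b'" using a'' by (intro mult_mono) auto
    then show "0 \<le> d * (a' * b' - a'' * b'')" "d * (a' * b' - a'' * b'') \<le> a' * b' - a'' * b''"
      using d by (auto simp: mult_left_le_one_le)
  qed
  \<comment> \<open>Passing to \<open>A''\<close>, \<open>B''\<close> lowers the edge count and its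
    expected value, each by an amount between 0 and \<open>a' * b' - a'' * b''\<close>; so the two
    changes differ by at most this amount, not by twice as much.\<close>
  ultimately have "\<bar>(real (edge_count E A' B') - d * (a' * b')) - (real (edge_count E A'' B'') - d * (a'' * b''))\<bar>
     \<le> a' * b' - a'' * b''"
    using ed unfolding right_diff_distrib by linarith
  then have "\<bar>real (edge_count E A'' B'') - d * (a'' * b'')\<bar> \<ge> eps ^ 3 * (a * b) - eps ^ 3 / 2 * (a * b)"
    using big1 prod_diff by linarith
  moreover have "eps ^ 3 * (a * b) - eps ^ 3 / 2 * (a * b) = eps ^ 3 / 2 * (a * b)" by simp
  ultimately have "\<bar>real (edge_count E A'' B'') - d * (a'' * b'')\<bar> \<ge> eps ^ 3 / 2 * (a * b)" by linarith
  then show ?thesis unfolding d_def a_def b_def a''_def b''_def .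
qed

lemma partition_on_UN:
  assumes P: "partition_on V P" and Q: "\<And>A. A \<in> P \<Longrightarrow> partition_on A (Q A)"
  shows "partition_on V (\<Union>(Q ` P))"
    and "\<And>A B. A \<in> P \<Longrightarrow> B \<in> P \<Longrightarrow> A \<noteq> B \<Longrightarrow> Q A \<inter> Q B = {}"
proof -
  have QA: "Z \<subseteq> A" "Z \<noteq> {}" if "A \<in> P" "Z \<in> Q A" for A Z
    using partition_onD1[OF Q[OF that(1)]] partition_onD3[OF Q[OF that(1)]] that by auto
  have disj: "A \<inter> B = {}" if "A \<in> P" "B \<in> P" "A \<noteq> B" for A B
    using partition_onD2[OF P] that by (auto simp: disjoint_def)
  show "Q A \<inter> Q B = {}" if "A \<in> P" "B \<in> P" "A \<noteq> B" for A B
  proof (rule ccontr)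
    assume "Q A \<inter> Q B \<noteq> {}"
    then obtain Z where "Z \<in> Q A" "Z \<in> Q B" by auto
    then show False using QA(1)[OF that(1)] QA(1)[OF that(2)] QA(2)[OF that(1)] disj[OF that] by blast
  qed
  show "partition_on V (\<Union>(Q ` P))"
  proof (rule partition_onI)
    show "\<Union>(\<Union>(Q ` P)) = V"
    proof -
      have "\<Union>(\<Union>(Q ` P)) = (\<Union>A\<in>P. \<Union>(Q A))" by blast
      also have "\<dots> = (\<Union>A\<in>P. A)" using partition_onD1[OF Q] by simp
      finally show ?thesis using partition_onD1[OF P] by simp
    qed
    show "{} \<notin> \<Union>(Q ` P)" using QA by auto
    fix Y Z assume "Y \<in> \<Union>(Q ` P)" "Z \<in> \<Union>(Q ` P)" "Y \<noteq> Z"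
    then obtain A B where AB: "A \<in> P" "B \<in> P" "Y \<in> Q A" "Z \<in> Q B" by auto
    show "disjnt Y Z"
    proof (cases "A = B")
      case True
      then show ?thesis
        using partition_onD2[OF Q[OF AB(1)]] AB \<open>Y \<noteq> Z\<close> by (auto simp: disjoint_def disjnt_def)
    next
      case False
      then show ?thesis using QA[OF AB(1,3)] QA[OF AB(2,4)] disj[OF AB(1,2)] by (auto simp: disjnt_def)
    qed
  qed
qed

lemma equipartition_card_bounds:
  assumes "equipartition V P" "finite V" "P \<noteq> {}" "A \<in> P"
  defines "a \<equiv> Min (card ` P)"
  shows "a > 0" "a \<le> card A" "card A \<le> a + 1" "card V \<le> card P * (a + 1)" "card P * a \<le> card V"
proof -
  have p: "partition_on V P" using assms by (simp add: equipartition_def)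
  have fP: "finite P" using p assms finite_elements by blast
  have "a \<in> card ` P" unfolding a_def using fP assms by (intro Min_in) auto
  then obtain Z where Z: "Z \<in> P" "a = card Z" by auto
  show "a > 0" using Z partition_on_finite_part[OF p assms(2)] by auto
  have le: "a \<le> card B" if "B \<in> P" for B unfolding a_def using fP that by auto
  have ge: "card B \<le> a + 1" if "B \<in> P" for B
    using assms(1) that Z by (auto simp: equipartition_def)
  show "a \<le> card A" "card A \<le> a + 1" using le ge assms by auto
  have c: "card V = (\<Sum>B\<in>P. card B)" by (rule partition_on_card[OF p assms(2)])
  show "card V \<le> card P * (a + 1)"
    unfolding c using sum_mono[of P card "\<lambda>_. a + 1"] ge by simp
  show "card P * a \<le> card V"
    unfolding c using sum_mono[of P "\<lambda>_. a" card] le by simp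
qed

text \<open>Ordered pairs, to match the double sum in \<open>energy\<close>.
  \<open>regular_equipartition\<close> counts sets \<open>{A, B}\<close>, each of which comes from
  at least one ordered pair.\<close>

definition irregular_pairs :: "real \<Rightarrow> nat set set \<Rightarrow> nat set set \<Rightarrow> (nat set \<times> nat set) set" where
  "irregular_pairs eps E P = {(A, B) \<in> P \<times> P. A \<noteq> B \<and> \<not> regular_pair eps E A B}"

text \<open>\<open>energy_defect\<close> is applied to every ordered pair of parts, the diagonal
  included. All variance terms are nonnegative, and those of \<open>I\<close> are at least
  \<open>g\<close>.\<close>

lemma energy_UN:
  assumes P: "partition_on V P" "finite V" and Q: "\<And>A. A \<in> P \<Longrightarrow> partition_on A (Q A)"
    and I: "I \<subseteq> P \<times> P" and gain: "\<And>A B. (A, B) \<in> I \<Longrightarrow>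
      g \<le> (\<Sum>C\<in>Q A. \<Sum>D\<in>Q B. real (card C) * real (card D) * (pair_density E C D - pair_density E A B)\<^sup>2)"
  shows "energy E (\<Union>(Q ` P)) \<ge> energy E P + real (card I) * g"
proof -
  let ?w = "\<lambda>C D. real (card C) * real (card D) * (pair_density E C D)\<^sup>2"
  let ?v = "\<lambda>A B. \<Sum>C\<in>Q A. \<Sum>D\<in>Q B. real (card C) * real (card D) * (pair_density E C D - pair_density E A B)\<^sup>2"
  have fP: "finite P" using P finite_elements by blast
  have fA: "finite A" "card A > 0" if "A \<in> P" for A
    using partition_on_finite_part[OF P that] by auto
  have fQ: "finite (Q A)" if "A \<in> P" for A using Q[OF that] fA[OF that] finite_elements by blast
  have s: "sum f (\<Union>(Q ` P)) = (\<Sum>A\<in>P. sum f (Q A))" for f :: "nat set \<Rightarrow> real"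
    by (rule sum.UNION_disjoint[OF fP]) (use fQ partition_on_UN(2)[OF P(1) Q] in auto)
  have "energy E (\<Union>(Q ` P)) = (\<Sum>A\<in>P. \<Sum>C\<in>Q A. \<Sum>B\<in>P. \<Sum>D\<in>Q B. ?w C D)"
    unfolding energy_def s ..
  also have "\<dots> = (\<Sum>A\<in>P. \<Sum>B\<in>P. \<Sum>C\<in>Q A. \<Sum>D\<in>Q B. ?w C D)"
    by (intro sum.cong refl sum.swap)
  also have "\<dots> = (\<Sum>A\<in>P. \<Sum>B\<in>P. real (card A) * real (card B) * (pair_density E A B)\<^sup>2 + ?v A B)"
    by (intro sum.cong refl energy_defect Q fA)
  also have "\<dots> = energy E P + (\<Sum>A\<in>P. \<Sum>B\<in>P. ?v A B)"
    by (simp add: sum.distrib energy_def)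
  also have "(\<Sum>A\<in>P. \<Sum>B\<in>P. ?v A B) = (\<Sum>z\<in>P\<times>P. ?v (fst z) (snd z))"
    by (simp add: sum.cartesian_product case_prod_beta)
  finally have e: "energy E (\<Union>(Q ` P)) = energy E P + (\<Sum>z\<in>P\<times>P. ?v (fst z) (snd z))" .
  have "real (card I) * g = (\<Sum>z\<in>I. g)" by simp
  also have "\<dots> \<le> (\<Sum>z\<in>I. ?v (fst z) (snd z))"
    using gain by (intro sum_mono) auto
  also have "\<dots> \<le> (\<Sum>z\<in>P\<times>P. ?v (fst z) (snd z))"
    using fP I by (intro sum_mono2) (auto intro!: sum_nonneg)
  finally show ?thesis using e by simp
qed

text \<open>Each part is split into \<open>t\<close> pieces along the Venn diagram of its witness
  sets, which has at most 4^k cells. The size of \<open>t\<close> keeps the pieces that straddle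
  cells below a fraction eps^3/4 of the part, so witnesses are nearly unions of pieces. With
  \<open>a\<close> the least part size, each irregular pair then gains eps^6/4 * a^2; there are at
  least eps |P|^2 of them, and |V| <= 2a |P|. The assumption \<open>big\<close> ensures that every
  part has at least \<open>t\<close> elements.\<close>

lemma energy_increment:
  assumes "eps > 0" "finite V" and P: "equipartition V P" "card P \<le> k"
    and t: "real t \<ge> 8 * 4 ^ k / eps ^ 3" and big: "card V > k * t"
    and irr: "real (card (irregular_pairs eps E P)) \<ge> eps * (real (card P))\<^sup>2"
  shows "\<exists>P'. equipartition V P' \<and> refines P' P \<and> card P' \<le> k * t \<and>
     energy E P' \<ge> energy E P + eps ^ 7 / 16 * (real (card V))\<^sup>2"
proof -
  have p: "partition_on V P" using P by (simp add: equipartition_def)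
  have fP: "finite P" using p assms finite_elements by blast
  have fA: "finite A" "card A > 0" if "A \<in> P" for A
    using partition_on_finite_part[OF p \<open>finite V\<close> that] by auto
  have neP: "P \<noteq> {}" using big partition_onD1[OF p] by auto
  define a where "a = Min (card ` P)"
  have ab: "a > 0" "a \<le> card A" "card A \<le> a + 1" "card V \<le> card P * (a + 1)" "card P * a \<le> card V" if "A \<in> P" for A
    using equipartition_card_bounds[OF P(1) \<open>finite V\<close> neP that] by (auto simp: a_def)
  obtain Z0 where Z0: "Z0 \<in> P" using neP by auto
  have "0 < 8 * 4 ^ k / eps ^ 3" using \<open>eps > 0\<close> by simp
  then have t0: "t > 0" using t by (smt (verit) gr0I of_nat_0)
  have at: "a \<ge> t"
  proof (rule ccontr)
    assume "\<not> a \<ge> t"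
    then have "card P * (a + 1) \<le> k * t" using P(2) by (intro mult_mono) auto
    then show False using ab(4)[OF Z0] big by linarith
  qed
  \<comment> \<open>Parts have size \<open>a\<close> or \<open>a + 1\<close>, and the same
    \<open>q\<close> serves for both; hence all new pieces, across all parts, have size
    \<open>q\<close> or \<open>q + 1\<close>.\<close>
  define q where "q = a div t"
  have q0: "q > 0" using at t0 by (simp add: q_def div_greater_zero_iff)
  have qa: "q * t \<le> a" "a + 1 \<le> (q + 1) * t"
  proof -
    have "a = q * t + a mod t" by (simp add: q_def)
    moreover have "a mod t < t" using t0 by simp
    ultimately show "q * t \<le> a" "a + 1 \<le> (q + 1) * t" by (auto simp: algebra_simps)
  qed
  define wit where "wit = (\<lambda>A B W. fst W \<subseteq> A \<and> snd W \<subseteq> B \<and>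
      real (card (fst W)) \<ge> eps * real (card A) \<and> real (card (snd W)) \<ge> eps * real (card B) \<and>
      \<bar>pair_density E A B - pair_density E (fst W) (snd W)\<bar> > eps)"
  define W where "W = (\<lambda>A B. SOME W. wit A B W)"
  have W: "wit A B (W A B)" if irr_AB: "(A, B) \<in> irregular_pairs eps E P" for A B
  proof -
    obtain A' B' where "A' \<subseteq> A" "B' \<subseteq> B" "real (card A') \<ge> eps * real (card A)"
        "real (card B') \<ge> eps * real (card B)" "\<bar>pair_density E A B - pair_density E A' B'\<bar> > eps"
      using irr_AB unfolding irregular_pairs_def regular_pair_def by (auto simp: not_le)
    then have "wit A B (A', B')" by (simp add: wit_def)
    then show ?thesis unfolding W_def by (rule someI)
  qed
  \<comment> \<open>\<open>A\<close> can be the first or the second member of an irregular pair,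
    with independently chosen witnesses, so both coordinates contribute.\<close>
  define \<W> where "\<W> = (\<lambda>A. (\<lambda>B. fst (W A B)) ` P \<union> (\<lambda>B. snd (W B A)) ` P)"
  define lab where "lab = (\<lambda>A x. {Y \<in> \<W> A. x \<in> Y})"
  have f\<W>: "finite (\<W> A)" for A unfolding \<W>_def using fP by simp
  have "card (\<W> A) \<le> 2 * k" for A
  proof -
    have "card (\<W> A) \<le> card ((\<lambda>B. fst (W A B)) ` P) + card ((\<lambda>B. snd (W B A)) ` P)"
      unfolding \<W>_def by (rule card_Un_le)
    also have "\<dots> \<le> card P + card P" by (intro add_mono card_image_le fP)
    finally show ?thesis using P(2) by simp
  qed
  then have cL: "card (Pow (\<W> A)) \<le> 4 ^ k" for A
  proof -
    have "card (Pow (\<W> A)) = 2 ^ card (\<W> A)" using f\<W> by (rule card_Pow)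
    also have "\<dots> \<le> 2 ^ (2 * k)" using \<open>card (\<W> A) \<le> 2 * k\<close> by (intro power_increasing) auto
    finally show ?thesis by (simp add: power_mult)
  qed
  define bad where "bad = (\<lambda>A Q. \<Union>{Z \<in> Q. \<not> (\<forall>x\<in>Z. \<forall>y\<in>Z. lab A x = lab A y)})"
  define split where "split = (\<lambda>A Q. partition_on A Q \<and> card Q = t \<and> (\<forall>Z\<in>Q. card Z = q \<or> card Z = q + 1) \<and>
      card (bad A Q) \<le> card (Pow (\<W> A)) * (q + 1))"
  have "\<exists>Q. split A Q" if "A \<in> P" for A
    unfolding split_def bad_def
  proof (rule equitable_split)
    show "lab A ` A \<subseteq> Pow (\<W> A)" by (auto simp: lab_def)
    show "q * t \<le> card A" "card A \<le> (q + 1) * t" using ab[OF that] qa by linarith+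
  qed (use f\<W> q0 fA that in auto)
  then obtain Q where "split A (Q A)" if "A \<in> P" for A by metis
  then have Q: "partition_on A (Q A)" "card (Q A) = t" "\<forall>Z\<in>Q A. card Z = q \<or> card Z = q + 1"
      "card (bad A (Q A)) \<le> card (Pow (\<W> A)) * (q + 1)" if "A \<in> P" for A
    using that unfolding split_def by auto
  have bad: "real (card (bad A (Q A))) \<le> eps ^ 3 / 4 * real (card A)" if "A \<in> P" for A
  proof -
    have "card (bad A (Q A)) \<le> 4 ^ k * (q + 1)"
      using Q(4)[OF that] cL[of A] by (meson le_trans mult_le_mono1)
    then have "real (card (bad A (Q A))) \<le> real (4 ^ k * (q + 1))" by (rule of_nat_mono)
    also have "\<dots> \<le> real (4 ^ k * (2 * q))" using q0 by (intro of_nat_mono mult_left_mono) auto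
    also have "\<dots> = 2 * 4 ^ k * real q" by simp
    also have "\<dots> \<le> (eps ^ 3 / 4 * real t) * real q"
    proof (intro mult_right_mono)
      have "eps ^ 3 / 4 * (8 * 4 ^ k / eps ^ 3) \<le> eps ^ 3 / 4 * real t"
        using t \<open>eps > 0\<close> by (intro mult_left_mono) auto
      then show "2 * 4 ^ k \<le> eps ^ 3 / 4 * real t" using \<open>eps > 0\<close> by simp
    qed simp
    also have "\<dots> = eps ^ 3 / 4 * real (q * t)" by simp
    also have "\<dots> \<le> eps ^ 3 / 4 * real (card A)"
      using qa ab[OF that] \<open>eps > 0\<close> by (intro mult_left_mono of_nat_mono) auto
    finally show ?thesis .
  qed
  let ?P' = "\<Union>(Q ` P)"
  have p': "partition_on V ?P'" using partition_on_UN(1)[OF p Q(1)] .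
  show ?thesis
  proof (intro exI conjI)
    have c: "card Z = q \<or> card Z = q + 1" if "Z \<in> ?P'" for Z using that Q(3) by auto
    show "equipartition V ?P'"
      unfolding equipartition_def
    proof (intro conjI ballI p')
      fix Y Z assume "Y \<in> ?P'" "Z \<in> ?P'"
      then show "card Y \<le> card Z + 1" using c[of Y] c[of Z] by linarith
    qed
    show "refines ?P' P"
      unfolding refines_def
    proof
      fix Z assume "Z \<in> ?P'"
      then obtain A where "A \<in> P" "Z \<in> Q A" by auto
      then show "\<exists>A\<in>P. Z \<subseteq> A" using partition_onD1[OF Q(1)] by (intro bexI[of _ A]) auto
    qed
    have "card ?P' \<le> (\<Sum>A\<in>P. card (Q A))" by (rule card_UN_le[OF fP])
    also have "\<dots> = card P * t" using Q(2) by simp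
    also have "\<dots> \<le> k * t" using P(2) by simp
    finally show "card ?P' \<le> k * t" .
    have gain: "eps ^ 6 / 4 * (real a)\<^sup>2 \<le>
       (\<Sum>C\<in>Q A. \<Sum>D\<in>Q B. real (card C) * real (card D) * (pair_density E C D - pair_density E A B)\<^sup>2)"
      (is "_ \<le> ?v") if AB: "(A, B) \<in> irregular_pairs eps E P" for A B
    proof -
      have A: "A \<in> P" and B: "B \<in> P" using AB by (auto simp: irregular_pairs_def)
      define A' B' where "A' = fst (W A B)" and "B' = snd (W A B)"
      note WAB = W[OF AB, unfolded wit_def, folded A'_def B'_def]
      define S T where "S = {Z \<in> Q A. Z \<subseteq> A'}" and "T = {Z \<in> Q B. Z \<subseteq> B'}"
      \<comment> \<open>A point of \<open>Y\<close> outside every piece contained in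
        \<open>Y\<close> lies in a piece that leaves \<open>Y\<close>, and membership in
        \<open>Y\<close> is part of the label.\<close>
      have cover: "Y - \<Union>{Z \<in> Q X. Z \<subseteq> Y} \<subseteq> bad X (Q X)" if "X \<in> P" "Y \<in> \<W> X" "Y \<subseteq> X" for X Y
      proof
        fix x assume x: "x \<in> Y - \<Union>{Z \<in> Q X. Z \<subseteq> Y}"
        then have "x \<in> \<Union>(Q X)" using partition_onD1[OF Q(1)[OF that(1)]] that by auto
        then obtain Z where Z: "Z \<in> Q X" "x \<in> Z" by auto
        then obtain y where y: "y \<in> Z" "y \<notin> Y" using x by auto
        have "Y \<in> lab X x" "Y \<notin> lab X y" using x y that by (auto simp: lab_def)
        then have "lab X x \<noteq> lab X y" by auto
        then show "x \<in> bad X (Q X)" unfolding bad_def using Z y by blast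
      qed
      have cb: "real (card (Y - \<Union>{Z \<in> Q X. Z \<subseteq> Y})) \<le> eps ^ 3 / 4 * real (card X)"
        if "X \<in> P" "Y \<in> \<W> X" "Y \<subseteq> X" for X Y
      proof -
        have "bad X (Q X) \<subseteq> X" unfolding bad_def using partition_onD1[OF Q(1)[OF that(1)]] by auto
        then have "finite (bad X (Q X))" using fA[OF that(1)] finite_subset by blast
        then have "card (Y - \<Union>{Z \<in> Q X. Z \<subseteq> Y}) \<le> card (bad X (Q X))"
          using cover[OF that] by (rule card_mono)
        then show ?thesis using bad[OF that(1)] by linarith
      qed
      have mem: "A' \<in> \<W> A" "B' \<in> \<W> B" using A B by (auto simp: \<W>_def A'_def B'_def)
      have disc: "eps ^ 3 / 2 * (real (card A) * real (card B)) \<le>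
         \<bar>real (edge_count E (\<Union>S) (\<Union>T)) - pair_density E A B * (real (card (\<Union>S)) * real (card (\<Union>T)))\<bar>"
      proof (rule irregular_discrepancy[where A' = A' and B' = B'])
        show "real (card (A' - \<Union>S)) \<le> eps ^ 3 / 4 * real (card A)"
          unfolding S_def by (rule cb) (use A mem WAB in auto)
        show "real (card (B' - \<Union>T)) \<le> eps ^ 3 / 4 * real (card B)"
          unfolding T_def by (rule cb) (use B mem WAB in auto)
      qed (use A B fA WAB \<open>eps > 0\<close> in \<open>auto simp: S_def T_def\<close>)
      define ab' where "ab' = real (card A) * real (card B)"
      have ab'0: "ab' > 0" and ab': "ab' > 0" "(real a)\<^sup>2 \<le> ab'"
        using fA[OF A] fA[OF B] ab(2)[OF A] ab(2)[OF B]
        by (auto simp: ab'_def power2_eq_square intro: mult_mono)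
      have "(eps ^ 3 / 2 * ab')\<^sup>2 \<le>
        (real (edge_count E (\<Union>S) (\<Union>T)) - pair_density E A B * (real (card (\<Union>S)) * real (card (\<Union>T))))\<^sup>2"
        using disc \<open>eps > 0\<close> ab' by (intro abs_le_square_iff[THEN iffD1]) (simp add: ab'_def abs_mult)
      also have "\<dots> \<le> ?v * ab'"
        unfolding ab'_def by (rule energy_defect_ge) (use A B Q fA in \<open>auto simp: S_def T_def\<close>)
      finally have "(eps ^ 3 / 2 * ab')\<^sup>2 \<le> ?v * ab'" .
      moreover have "(eps ^ 3 / 2 * ab')\<^sup>2 = (eps ^ 6 / 4 * ab') * ab'"
        by (simp add: power2_eq_square power_numeral_reduce)
      ultimately have "(eps ^ 6 / 4 * ab') * ab' \<le> ?v * ab'" by (simp only:)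
      then have "eps ^ 6 / 4 * ab' \<le> ?v" by (rule mult_right_le_imp_le[OF _ ab'0])
      moreover have "eps ^ 6 / 4 * (real a)\<^sup>2 \<le> eps ^ 6 / 4 * ab'"
        using ab' \<open>eps > 0\<close> by (intro mult_left_mono) auto
      ultimately show ?thesis by linarith
    qed
    have "energy E P + real (card (irregular_pairs eps E P)) * (eps ^ 6 / 4 * (real a)\<^sup>2) \<le> energy E ?P'"
      by (rule energy_UN[OF p \<open>finite V\<close> Q(1) _ gain]) (auto simp: irregular_pairs_def)
    moreover have "eps ^ 7 / 16 * (real (card V))\<^sup>2 \<le>
        real (card (irregular_pairs eps E P)) * (eps ^ 6 / 4 * (real a)\<^sup>2)"
    proof -
      have "card P * (a + 1) \<le> card P * (2 * a)"
        using ab(1)[OF Z0] by (intro mult_left_mono) auto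
      then have "card V \<le> card P * (2 * a)" using ab(4)[OF Z0] by linarith
      then have "real (card V) \<le> real (card P * (2 * a))" by (rule of_nat_mono)
      then have "(real (card V))\<^sup>2 \<le> (real (card P * (2 * a)))\<^sup>2"
        by (intro power_mono) auto
      then have "eps ^ 7 / 16 * (real (card V))\<^sup>2 \<le> eps ^ 7 / 16 * (real (card P * (2 * a)))\<^sup>2"
        using \<open>eps > 0\<close> by (intro mult_left_mono) auto
      also have "\<dots> = (eps * (real (card P))\<^sup>2) * (eps ^ 6 / 4 * (real a)\<^sup>2)"
        by (simp add: power2_eq_square power_numeral_reduce)
      also have "\<dots> \<le> real (card (irregular_pairs eps E P)) * (eps ^ 6 / 4 * (real a)\<^sup>2)"
        using irr by (intro mult_right_mono) (use \<open>eps > 0\<close> in auto)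
      finally show ?thesis .
    qed
    ultimately show "energy E P + eps ^ 7 / 16 * (real (card V))\<^sup>2 \<le> energy E ?P'" by linarith
  qed
qed

section \<open>Iterating the increment; bounds on \<open>S_reg\<close>\<close>

lemma refines_transitive: "refines P Q \<Longrightarrow> refines Q R \<Longrightarrow> refines P R"
  unfolding Defs.refines_def by (meson subset_trans)

lemma refines_reflexive: "refines P P"
  unfolding Defs.refines_def by blast

lemma card_irregular_le:
  assumes "finite P"
  shows "card {{A, B} | A B. A \<in> P \<and> B \<in> P \<and> A \<noteq> B \<and> \<not> regular_pair eps E A B}
    \<le> card (irregular_pairs eps E P)"
proof -
  have "{{A, B} | A B. A \<in> P \<and> B \<in> P \<and> A \<noteq> B \<and> \<not> regular_pair eps E A B}
     = (\<lambda>(A, B). {A, B}) ` irregular_pairs eps E P"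
    by (auto simp: irregular_pairs_def image_iff)
  moreover have "finite (irregular_pairs eps E P)"
    by (rule finite_subset[of _ "P \<times> P"]) (use assms in \<open>auto simp: irregular_pairs_def\<close>)
  ultimately show ?thesis by (simp add: card_image_le)
qed

lemma equipartition_singletons: "equipartition V ((\<lambda>x. {x}) ` V)"
  unfolding equipartition_def using partition_on_singletons by auto

text \<open>The way out for graphs with too few vertices for \<open>energy_increment\<close>. As
  \<open>eps\<close> is positive, the only admissible subset of a singleton is the singleton
  itself.\<close>

lemma regular_equipartition_singletons:
  assumes "eps > 0"
  shows "regular_equipartition eps V E ((\<lambda>x. {x}) ` V)"
proof -
  have "regular_pair eps E {x} {y}" for x y
    unfolding regular_pair_def
  proof (intro allI impI)
    fix A B assume A: "A \<subseteq> {x}" and B: "B \<subseteq> {y}"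
      and c: "eps * real (card {x}) \<le> real (card A) \<and> eps * real (card {y}) \<le> real (card B)"
    have "A \<noteq> {}" "B \<noteq> {}" using c assms by auto
    then have "A = {x}" "B = {y}" using A B by auto
    then show "\<bar>pair_density E {x} {y} - pair_density E A B\<bar> \<le> eps" using assms by simp
  qed
  then have e: "{{A, B} | A B. A \<in> (\<lambda>x. {x}) ` V \<and> B \<in> (\<lambda>x. {x}) ` V \<and> A \<noteq> B \<and> \<not> regular_pair eps E A B} = {}"
    by blast
  show ?thesis
    unfolding regular_equipartition_def e using equipartition_singletons assms by simp
qed

lemma refines_singletons:
  assumes "partition_on V P"
  shows "refines ((\<lambda>x. {x}) ` V) P"
  unfolding Defs.refines_def using partition_onD1[OF assms] by auto

text \<open>\<open>j\<close> bounds the number of increments still possible: each irregular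
  partition is replaced by one with energy larger by eps^7/16 * |V|^2, and at \<open>j = 0\<close>
  this would exceed the ceiling |V|^2. The induction generalises \<open>k\<close>, since an
  increment multiplies the order by up to \<open>t\<close>. That \<open>S\<close> is chosen before
  the graph is the uniformity that \<open>S_reg\<close> asks for.\<close>

lemma regularity_iteration:
  assumes "eps > 0"
  shows "\<exists>S. \<forall>V E P. finite V \<and> equipartition V P \<and> card P \<le> k \<and>
      energy E P \<ge> (1 - real j * (eps ^ 7 / 16)) * (real (card V))\<^sup>2 \<longrightarrow>
      (\<exists>P'. regular_equipartition eps V E P' \<and> refines P' P \<and> card P' \<le> S)"
proof (induction j arbitrary: k)
  case 0
  obtain t :: nat where t: "real t \<ge> 8 * 4 ^ k / eps ^ 3" using real_arch_simple by blast
  show ?case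
  proof (intro exI[of _ "max k (k * t)"] allI impI, elim conjE)
    fix V E P
    assume V: "finite V" and P: "equipartition V P" "card P \<le> k"
      and en: "energy E P \<ge> (1 - real 0 * (eps ^ 7 / 16)) * (real (card V))\<^sup>2"
    have p: "partition_on V P" using P by (simp add: equipartition_def)
    have fP: "finite P" using p V finite_elements by blast
    consider "regular_equipartition eps V E P" | "card V \<le> k * t"
      | "\<not> regular_equipartition eps V E P" "card V > k * t" by linarith
    then show "\<exists>P'. regular_equipartition eps V E P' \<and> refines P' P \<and> card P' \<le> max k (k * t)"
    proof cases
      case 1
      then show ?thesis using P refines_reflexive by (meson le_max_iff_disj)
    next
      case 2
      then have "card ((\<lambda>x. {x}) ` V) \<le> max k (k * t)"
        by (meson card_image_le V le_trans max.cobounded2)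
      then show ?thesis using regular_equipartition_singletons[OF assms] refines_singletons[OF p] by blast
    next
      case 3
      then have "real (card (irregular_pairs eps E P)) \<ge> eps * (real (card P))\<^sup>2"
        using card_irregular_le[OF fP, of eps E] P(1) unfolding regular_equipartition_def by simp
      then obtain P' where P': "equipartition V P'" "energy E P' \<ge> energy E P + eps ^ 7 / 16 * (real (card V))\<^sup>2"
        using energy_increment[OF assms V P t 3(2)] by blast
      moreover have "energy E P' \<le> (real (card V))\<^sup>2"
        using P'(1) V by (intro energy_le) (auto simp: equipartition_def)
      \<comment> \<open>Strictness needs a nonempty \<open>V\<close>, which
        \<open>card V > k * t\<close> provides.\<close>
      moreover have "eps ^ 7 / 16 * (real (card V))\<^sup>2 > 0"
        using assms 3(2) by (intro mult_pos_pos) auto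
      ultimately have False using en by simp
      then show ?thesis ..
    qed
  qed
next
  case (Suc j)
  obtain t :: nat where t: "real t \<ge> 8 * 4 ^ k / eps ^ 3" using real_arch_simple by blast
  obtain S where S: "\<And>V E P. finite V \<Longrightarrow> equipartition V P \<Longrightarrow> card P \<le> k * t \<Longrightarrow>
      energy E P \<ge> (1 - real j * (eps ^ 7 / 16)) * (real (card V))\<^sup>2 \<Longrightarrow>
      (\<exists>P'. regular_equipartition eps V E P' \<and> refines P' P \<and> card P' \<le> S)"
    using Suc.IH[of "k * t"] by blast
  show ?case
  proof (intro exI[of _ "max S (max k (k * t))"] allI impI, elim conjE)
    fix V E P
    assume V: "finite V" and P: "equipartition V P" "card P \<le> k"
      and en: "energy E P \<ge> (1 - real (Suc j) * (eps ^ 7 / 16)) * (real (card V))\<^sup>2"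
    have p: "partition_on V P" using P by (simp add: equipartition_def)
    have fP: "finite P" using p V finite_elements by blast
    consider "regular_equipartition eps V E P" | "card V \<le> k * t"
      | "\<not> regular_equipartition eps V E P" "card V > k * t" by linarith
    then show "\<exists>P'. regular_equipartition eps V E P' \<and> refines P' P \<and> card P' \<le> max S (max k (k * t))"
    proof cases
      case 1
      then show ?thesis using P refines_reflexive by (meson le_max_iff_disj)
    next
      case 2
      then have "card ((\<lambda>x. {x}) ` V) \<le> max S (max k (k * t))"
        using card_image_le[OF V, of "\<lambda>x. {x}"] by linarith
      then show ?thesis using regular_equipartition_singletons[OF assms] refines_singletons[OF p] by blast
    next
      case 3
      then have "real (card (irregular_pairs eps E P)) \<ge> eps * (real (card P))\<^sup>2"
        using card_irregular_le[OF fP, of eps E] P(1) unfolding regular_equipartition_def by simp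
      then obtain Q where Q: "equipartition V Q" "refines Q P" "card Q \<le> k * t"
          "energy E Q \<ge> energy E P + eps ^ 7 / 16 * (real (card V))\<^sup>2"
        using energy_increment[OF assms V P t 3(2)] by blast
      have "energy E Q \<ge> (1 - real j * (eps ^ 7 / 16)) * (real (card V))\<^sup>2"
      proof -
        have "(1 - real (Suc j) * \<gamma>) * x = (1 - real j * \<gamma>) * x - \<gamma> * x" for \<gamma> x :: real
          by (simp add: algebra_simps)
        from this[of "eps ^ 7 / 16" "(real (card V))\<^sup>2"] show ?thesis using Q(4) en by linarith
      qed
      from S[OF V Q(1,3) this] obtain P' where "regular_equipartition eps V E P'" "refines P' Q" "card P' \<le> S"
        by blast
      then show ?thesis using refines_transitive[OF _ Q(2)] by (meson le_max_iff_disj)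
    qed
  qed
qed

lemma szemeredi_regularity:
  assumes "eps > 0"
  shows "\<exists>S. \<forall>V E P. finite V \<and> equipartition V P \<and> card P \<le> k \<longrightarrow>
      (\<exists>P'. regular_equipartition eps V E P' \<and> refines P' P \<and> card P' \<le> S)"
proof -
  \<comment> \<open>For this \<open>j\<close> the lower bound required of the energy is not
    positive, so every partition meets it.\<close>
  obtain j :: nat where "real j \<ge> 16 / eps ^ 7" using real_arch_simple by blast
  then have "1 - real j * (eps ^ 7 / 16) \<le> 0" using assms by (simp add: field_simps)
  then have en: "energy E P \<ge> (1 - real j * (eps ^ 7 / 16)) * (real (card V))\<^sup>2" for V :: "nat set" and E P
    using energy_nonneg[of E P] by (meson mult_nonpos_nonneg order_trans zero_le_power2)
  obtain S where S: "\<forall>V E P. finite V \<and> equipartition V P \<and> card P \<le> k \<and>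
      energy E P \<ge> (1 - real j * (eps ^ 7 / 16)) * (real (card V))\<^sup>2 \<longrightarrow>
      (\<exists>P'. regular_equipartition eps V E P' \<and> refines P' P \<and> card P' \<le> S)"
    using regularity_iteration[OF assms, of k j] ..
  show ?thesis
    by (intro exI[of _ S] allI impI S[rule_format]) (use en in auto)
qed

text \<open>The regularity lemma, applied without editing any edge, shows that the \<open>LEAST\<close> in
  \<^const>\<open>S_reg\<close> is attained.\<close>

lemma S_reg_spec:
  assumes "eps > 0" "delta \<ge> 0"
    and "simple_graph V E" "graph_density V E \<ge> p" "equipartition V P0" "real (card P0) \<le> 1 / eps"
  obtains E' P where "simple_graph V E'" "real (card ((E - E') \<union> (E' - E))) \<le> delta * real (card E)"
    "regular_equipartition eps V E' P" "refines P P0" "card P \<le> S_reg eps delta p"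
proof -
  define good where "good = (\<lambda>S :: nat. \<forall>V E P0.
      simple_graph V E \<and> graph_density V E \<ge> p \<and> equipartition V P0 \<and> real (card P0) \<le> 1 / eps \<longrightarrow>
      (\<exists>E'. simple_graph V E' \<and> real (card ((E - E') \<union> (E' - E))) \<le> delta * real (card E) \<and>
         (\<exists>P. regular_equipartition eps V E' P \<and> refines P P0 \<and> card P \<le> S)))"
  obtain k :: nat where k: "real k \<ge> 1 / eps" using real_arch_simple by blast
  obtain S where S: "\<And>V E P. finite V \<Longrightarrow> equipartition V P \<Longrightarrow> card P \<le> k \<Longrightarrow>
      (\<exists>P'. regular_equipartition eps V E P' \<and> refines P' P \<and> card P' \<le> S)"
    using szemeredi_regularity[OF assms(1), of k] by blast
  have "good S"
    unfolding good_def
  proof (intro allI impI, elim conjE)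
    fix V E P0
    assume V: "simple_graph V E" and P0: "equipartition V P0" "real (card P0) \<le> 1 / eps"
    have "card P0 \<le> k" using P0(2) k by linarith
    then obtain P where "regular_equipartition eps V E P" "refines P P0" "card P \<le> S"
      using S[of V P0 E] V P0(1) by (auto simp: simple_graph_def)
    then show "\<exists>E'. simple_graph V E' \<and> real (card ((E - E') \<union> (E' - E))) \<le> delta * real (card E) \<and>
         (\<exists>P. regular_equipartition eps V E' P \<and> refines P P0 \<and> card P \<le> S)"
      using V assms(2) by (intro exI[of _ E]) auto
  qed
  then have "good (S_reg eps delta p)"
    unfolding S_reg_def good_def by (rule LeastI)
  then show ?thesis using that assms(3-6) unfolding good_def by blast
qed

text \<open>\<open>equitable_split\<close> with a one-element label type, for the sake of its part
  sizes.\<close>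

lemma equipartition_exists:
  assumes "finite V" "0 < k" "k \<le> card V"
  obtains P where "equipartition V P" "card P = k"
proof -
  define q where "q = card V div k"
  have q: "q > 0" using assms by (simp add: q_def div_greater_zero_iff)
  have "card V = q * k + card V mod k" by (simp add: q_def)
  moreover have "card V mod k < k" using assms by simp
  ultimately have "q * k \<le> card V" "card V \<le> (q + 1) * k" by (auto simp: algebra_simps)
  then have "\<exists>P. partition_on V P \<and> card P = k \<and> (\<forall>Z\<in>P. card Z = q \<or> card Z = q + 1) \<and>
      card (\<Union>{Z \<in> P. \<not> (\<forall>x\<in>Z. \<forall>y\<in>Z. () = ())}) \<le> card {()} * (q + 1)"
    by (intro equitable_split q assms(1)) auto
  then obtain P where P: "partition_on V P" "card P = k" "\<forall>Z\<in>P. card Z = q \<or> card Z = q + 1"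
    by (elim exE conjE)
  have "equipartition V P"
    unfolding equipartition_def
  proof (intro conjI ballI P(1))
    fix Y Z assume "Y \<in> P" "Z \<in> P"
    then have "card Y = q \<or> card Y = q + 1" "card Z = q \<or> card Z = q + 1" using P(3) by simp_all
    then show "card Y \<le> card Z + 1" by linarith
  qed
  then show ?thesis using P(2) by (rule that)
qed

text \<open>Complete graphs, partitioned into singletons, force the order of the refinement up.\<close>

lemma S_reg_ge:
  assumes "eps > 0" "delta \<ge> 0" "p \<le> 1 / 2" "k \<ge> 2" "real k \<le> 1 / eps"
  shows "k \<le> S_reg eps delta p"
proof -
  define V where "V = {..<k}"
  define E where "E = {{u, v} | u v. u \<in> V \<and> v \<in> V \<and> u \<noteq> v}"
  define P0 where "P0 = (\<lambda>x. {x}) ` V"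
  have E: "E = {X. X \<subseteq> V \<and> card X = 2}"
    unfolding E_def by (auto simp: card_2_iff)
  have V: "finite V" "card V = k" by (auto simp: V_def)
  have cE: "real (card E) = real k * (real k - 1) / 2"
  proof -
    have "card E = k choose 2" unfolding E using n_subsets[OF V(1), of 2] V by simp
    moreover have "2 * (k choose 2) = k * (k - 1)" using times_binomial_minus1_eq[of 2 k] by simp
    ultimately have "2 * real (card E) = real (k * (k - 1))" by (metis of_nat_mult of_nat_numeral)
    then show ?thesis using assms(4) by (simp add: of_nat_diff)
  qed
  have sg: "simple_graph V E" using V by (simp add: simple_graph_def E_def)
  have "graph_density V E = (real k - 1) / real k"
    unfolding graph_density_def cE V using assms(4) by (simp add: power2_eq_square)
  also have "\<dots> \<ge> 1 / 2" using assms(4) by (simp add: field_simps)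
  finally have dens: "graph_density V E \<ge> p" using assms(3) by linarith
  have "card P0 = k" unfolding P0_def using V by (simp add: card_image)
  then obtain E' P where P: "regular_equipartition eps V E' P" "refines P P0" "card P \<le> S_reg eps delta p"
    using S_reg_spec[OF assms(1,2) sg dens, of P0] equipartition_singletons assms(5) unfolding P0_def by metis
  have p: "partition_on V P" using P by (simp add: regular_equipartition_def equipartition_def)
  have "card V = (\<Sum>C\<in>P. card C)" by (rule partition_on_card[OF p V(1)])
  \<comment> \<open>A refinement of the singletons has parts of size at most 1, whatever edges were
    edited.\<close>
  also have "\<dots> \<le> (\<Sum>C\<in>P. 1)"
  proof (rule sum_mono)
    fix C assume "C \<in> P"
    then obtain x where "C \<subseteq> {x}" using P(2) by (auto simp: Defs.refines_def P0_def)
    then show "card C \<le> 1" using card_mono[of "{x}" C] by simp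
  qed
  finally show ?thesis using V P(3) by simp
qed

section \<open>Counting embeddings\<close>

lemma pair_density_commute: "pair_density E A B = pair_density E B A"
  by (simp add: pair_density_def edge_count_commute[of E A B] mult.commute)

text \<open>Regularity as a cut-norm bound for all subsets, large or not: if one subset falls below
  its threshold, the trivial bound |A'||B'| is already at most \<eta> |A||B|. Empty sets are a
  separate case because for \<eta> = 0 they pass the threshold while their density is the default
  0.\<close>

lemma regular_pair_discrepancy:
  assumes reg: "regular_pair \<eta> E A B" and fin: "finite A" "finite B" and sub: "A' \<subseteq> A" "B' \<subseteq> B" and "\<eta> \<ge> 0"
  shows "\<bar>real (edge_count E A' B') - pair_density E A B * (real (card A') * real (card B'))\<bar>
    \<le> \<eta> * (real (card A) * real (card B))"
proof -
  let ?e = "real (edge_count E A' B')" and ?d = "pair_density E A B"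
  have fin': "finite A'" "finite B'" using fin sub finite_subset by auto
  have ca: "real (card A') \<le> real (card A)" "real (card B') \<le> real (card B)"
    using fin sub by (auto intro: card_mono)
  have d: "0 \<le> ?d" "?d \<le> 1" using pair_density_bounds[OF fin] by auto
  have e: "0 \<le> ?e" "?e \<le> real (card A') * real (card B')"
    using edge_count_le[OF fin', of E] by (simp_all flip: of_nat_mult)
  have dd: "0 \<le> ?d * (real (card A') * real (card B'))"
      "?d * (real (card A') * real (card B')) \<le> real (card A') * real (card B')"
    using d by (auto simp: mult_left_le_one_le)
  have triv: "\<bar>?e - ?d * (real (card A') * real (card B'))\<bar> \<le> real (card A') * real (card B')"
    using e dd by linarith
  consider "real (card A') < \<eta> * real (card A)" | "real (card B') < \<eta> * real (card B)"
    | "card A' = 0 \<or> card B' = 0"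
    | "real (card A') \<ge> \<eta> * real (card A)" "real (card B') \<ge> \<eta> * real (card B)" "card A' > 0" "card B' > 0"
    by linarith
  then show ?thesis
  proof cases
    case 1
    then have "real (card A') * real (card B') \<le> (\<eta> * real (card A)) * real (card B)"
      using ca by (intro mult_mono) auto
    then show ?thesis using triv by (simp add: mult.assoc)
  next
    case 2
    then have "real (card A') * real (card B') \<le> real (card A) * (\<eta> * real (card B))"
      using ca by (intro mult_mono) auto
    then show ?thesis using triv by (simp add: mult_ac)
  next
    case 3
    then have "real (card A') * real (card B') = 0" by auto
    moreover have "0 \<le> \<eta> * (real (card A) * real (card B))" using assms by simp
    ultimately show ?thesis using triv by linarith
  next
    case 4
    then have *: "\<bar>?d - pair_density E A' B'\<bar> \<le> \<eta>"
      using reg sub unfolding regular_pair_def by blast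
    have "?e - ?d * (real (card A') * real (card B')) =
        (pair_density E A' B' - ?d) * (real (card A') * real (card B'))"
      using 4 by (simp add: edge_count_eq_density algebra_simps)
    then have "\<bar>?e - ?d * (real (card A') * real (card B'))\<bar> =
        \<bar>?d - pair_density E A' B'\<bar> * (real (card A') * real (card B'))"
      by (simp add: abs_mult abs_minus_commute)
    also have "\<dots> \<le> \<eta> * (real (card A) * real (card B))"
      using * ca \<open>\<eta> \<ge> 0\<close> by (intro mult_mono) auto
    finally show ?thesis .
  qed
qed

text \<open>Counting maps by freezing all images but those of \<open>u\<close> and \<open>v\<close>;
  restriction and double update are mutually inverse.\<close>

lemma card_PiE_two:
  fixes X :: "'a \<Rightarrow> 'b set"
  assumes "finite VH" "u \<in> VH" "v \<in> VH" "u \<noteq> v" "\<And>w. w \<in> VH \<Longrightarrow> finite (X w)"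
  shows "card {f \<in> PiE VH X. P f} =
    (\<Sum>g\<in>PiE (VH - {u, v}) X. card {(x, y). x \<in> X u \<and> y \<in> X v \<and> P (g(u := x, v := y))})"
proof -
  let ?G = "PiE (VH - {u, v}) X"
  let ?C = "\<lambda>g. {(x, y). x \<in> X u \<and> y \<in> X v \<and> P (g(u := x, v := y))}"
  have "bij_betw (\<lambda>(g, x, y). g(u := x, v := y)) (SIGMA g:?G. ?C g) {f \<in> PiE VH X. P f}"
  proof (rule bij_betwI[of _ _ _ "\<lambda>f. (restrict f (VH - {u, v}), f u, f v)"])
    have up: "g(u := x, v := y) \<in> PiE VH X" if g: "g \<in> ?G" and xy: "x \<in> X u" "y \<in> X v" for g x y
    proof (rule PiE_I)
      fix w assume "w \<in> VH"
      then show "(g(u := x, v := y)) w \<in> X w"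
        using PiE_mem[OF g, of w] xy by (cases "w = v"; cases "w = u") simp_all
    next
      fix w assume "w \<notin> VH"
      then have "w \<noteq> u" "w \<noteq> v" using assms(2,3) by auto
      then show "(g(u := x, v := y)) w = undefined"
        using PiE_arb[OF g, of w] \<open>w \<notin> VH\<close> by simp
    qed
    have res: "restrict f (VH - {u, v}) \<in> ?G" if f: "f \<in> PiE VH X" for f
      using PiE_mem[OF f] by (intro restrict_PiE_iff[THEN iffD2]) simp
    have eq: "(restrict f (VH - {u, v}))(u := f u, v := f v) = f" if f: "f \<in> PiE VH X" for f
    proof
      fix w
      show "((restrict f (VH - {u, v}))(u := f u, v := f v)) w = f w"
        using PiE_arb[OF f, of w] by (cases "w \<in> VH - {u, v}") auto
    qed
    have eq': "restrict (g(u := x, v := y)) (VH - {u, v}) = g" if g: "g \<in> ?G" for g x y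
    proof
      fix w
      show "restrict (g(u := x, v := y)) (VH - {u, v}) w = g w"
        using PiE_arb[OF g, of w] by (cases "w \<in> VH - {u, v}") auto
    qed
    show "(\<lambda>(g, x, y). g(u := x, v := y)) \<in> (SIGMA g:?G. ?C g) \<rightarrow> {f \<in> PiE VH X. P f}"
    proof
      fix z assume z: "z \<in> (SIGMA g:?G. ?C g)"
      obtain g x y where z': "z = (g, x, y)" by (cases z) auto
      have "g \<in> ?G" "x \<in> X u" "y \<in> X v" "P (g(u := x, v := y))" using z unfolding z' by simp_all
      then show "(\<lambda>(g, x, y). g(u := x, v := y)) z \<in> {f \<in> PiE VH X. P f}"
        using up by (simp add: z')
    qed
    show "(\<lambda>f. (restrict f (VH - {u, v}), f u, f v)) \<in> {f \<in> PiE VH X. P f} \<rightarrow> (SIGMA g:?G. ?C g)"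
    proof
      fix f assume "f \<in> {f \<in> PiE VH X. P f}"
      then have f: "f \<in> PiE VH X" "P f" by simp_all
      show "(restrict f (VH - {u, v}), f u, f v) \<in> (SIGMA g:?G. ?C g)"
        using res[OF f(1)] eq[OF f(1)] f(2) PiE_mem[OF f(1) assms(2)] PiE_mem[OF f(1) assms(3)] by simp
    qed
    show "(\<lambda>f. (restrict f (VH - {u, v}), f u, f v)) ((\<lambda>(g, x, y). g(u := x, v := y)) z) = z"
      if z: "z \<in> (SIGMA g:?G. ?C g)" for z
    proof -
      obtain g x y where z': "z = (g, x, y)" by (cases z) auto
      have "g \<in> ?G" using z unfolding z' by simp
      then show ?thesis using eq' assms(4) by (simp add: z')
    qed
    show "(\<lambda>(g, x, y). g(u := x, v := y)) ((\<lambda>f. (restrict f (VH - {u, v}), f u, f v)) f) = f"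
      if f: "f \<in> {f \<in> PiE VH X. P f}" for f
      using eq f by simp
  qed
  then have "card {f \<in> PiE VH X. P f} = card (SIGMA g:?G. ?C g)"
    by (rule bij_betw_same_card[symmetric])
  also have "\<dots> = (\<Sum>g\<in>?G. card (?C g))"
  proof (rule card_SigmaI)
    show "finite ?G" using assms by (intro finite_PiE) auto
    have "finite (?C g)" for g
      by (rule finite_subset[of _ "X u \<times> X v"]) (use assms in auto)
    then show "\<forall>g\<in>?G. finite (?C g)" by blast
  qed
  finally show ?thesis .
qed

lemma prod_remove_two:
  fixes w :: "'a \<Rightarrow> 'b :: comm_monoid_mult"
  assumes "finite VH" "u \<in> VH" "v \<in> VH" "u \<noteq> v"
  shows "prod w VH = prod w (VH - {u, v}) * (w u * w v)"
proof -
  have "prod w VH = prod w (VH - {u, v}) * prod w {u, v}"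
    using assms by (intro prod.subset_diff) auto
  then show ?thesis using assms by simp
qed

lemma simple_graph_edgeE:
  assumes "simple_graph V E" "e \<in> E"
  obtains u v where "e = {u, v}" "u \<in> V" "v \<in> V" "u \<noteq> v"
  using assms unfolding simple_graph_def by blast

lemma simple_graph_finite:
  assumes "simple_graph V E"
  shows "finite V" "finite E"
proof -
  show "finite V" using assms by (simp add: simple_graph_def)
  moreover have "E \<subseteq> Pow V" using assms by (auto simp: simple_graph_def)
  ultimately show "finite E" using finite_subset by blast
qed

lemma simple_graph_subset: "simple_graph V E \<Longrightarrow> E1 \<subseteq> E \<Longrightarrow> simple_graph V E1"
  unfolding simple_graph_def by blast

section \<open>Counting maps of H into a system of vertex sets, which may overlap or
  coincide\<close>

context
  fixes VH :: "nat set" and EH :: "nat set set" and X :: "nat \<Rightarrow> nat set"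
  assumes H: "simple_graph VH EH"
    and fX: "\<And>w. w \<in> VH \<Longrightarrow> finite (X w)"
begin

text \<open>Every edge \<open>e\<close> of H has a target graph \<open>Q e\<close> of its own, so
  that one edge can be sent to \<open>E' - E\<close> and the others to \<open>E'\<close>;
  \<open>K\<close> holds the constraints imposed so far.\<close>

definition homs :: "(nat set \<Rightarrow> nat set set) \<Rightarrow> nat set set \<Rightarrow> nat" where
  "homs Q K = card {f \<in> PiE VH X. \<forall>e\<in>K. f ` e \<in> Q e}"

text \<open>Cut distance between the bipartite graph over \<open>e\<close> and the constant density
  \<open>d\<close>. Quantifying over \<open>u\<close> and \<open>v\<close> with
  \<open>e = {u, v}\<close> covers both orientations.\<close>

definition cut_close :: "real \<Rightarrow> nat set set \<Rightarrow> real \<Rightarrow> nat set \<Rightarrow> bool" where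
  "cut_close \<eta> Q d e \<longleftrightarrow> (\<forall>u v A B. e = {u, v} \<longrightarrow> A \<subseteq> X u \<longrightarrow> B \<subseteq> X v \<longrightarrow>
     \<bar>real (edge_count Q A B) - d * (real (card A) * real (card B))\<bar> \<le> \<eta> * (real (card (X u)) * real (card (X v))))"

abbreviation \<Pi>X :: real where
  "\<Pi>X \<equiv> (\<Prod>w\<in>VH. real (card (X w)))"

lemmas edge_cases = simple_graph_edgeE[OF H]
  and finite_VH = simple_graph_finite(1)[OF H]
  and finite_EH = simple_graph_finite(2)[OF H]

lemma card_PiE_rest: "real (card (PiE (VH - {u, v}) X)) = (\<Prod>w\<in>VH - {u, v}. real (card (X w)))"
  using finite_VH by (simp add: card_PiE)

lemma card_homs_two:
  assumes "u \<in> VH" "v \<in> VH" "u \<noteq> v"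
  shows "card {f \<in> PiE VH X. P f} =
    (\<Sum>g\<in>PiE (VH - {u, v}) X. card {(x, y). x \<in> X u \<and> y \<in> X v \<and> P (g(u := x, v := y))})"
  by (rule card_PiE_two[OF finite_VH assms]) (rule fX)

text \<open>For fixed images of the other vertices, an edge other than \<open>{u, v}\<close> constrains at most
  one of the images of \<open>u\<close> and \<open>v\<close>, so the constraints cut out a product set.\<close>

lemma homs_insert:
  assumes e: "e \<in> EH" and K: "K \<subseteq> EH" "e \<notin> K" and cut: "cut_close \<eta> (Q e) d e"
  shows "\<bar>real (homs Q (insert e K)) - d * real (homs Q K)\<bar> \<le> \<eta> * \<Pi>X"
proof -
  obtain u v where uv: "e = {u, v}" "u \<in> VH" "v \<in> VH" "u \<noteq> v" using edge_cases[OF e] .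
  let ?G = "PiE (VH - {u, v}) X"
  define c where "c = (\<lambda>g :: nat \<Rightarrow> nat. \<forall>e\<in>K. u \<notin> e \<and> v \<notin> e \<longrightarrow> g ` e \<in> Q e)"
  define A where "A = (\<lambda>g. {x \<in> X u. \<forall>e\<in>K. u \<in> e \<longrightarrow> (g(u := x)) ` e \<in> Q e})"
  define B where "B = (\<lambda>g. {y \<in> X v. \<forall>e\<in>K. v \<in> e \<longrightarrow> (g(v := y)) ` e \<in> Q e})"
  have key: "(\<forall>e\<in>K. (g(u := x, v := y)) ` e \<in> Q e) \<longleftrightarrow>
      c g \<and> (\<forall>e\<in>K. u \<in> e \<longrightarrow> (g(u := x)) ` e \<in> Q e) \<and> (\<forall>e\<in>K. v \<in> e \<longrightarrow> (g(v := y)) ` e \<in> Q e)" for g x y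
  proof -
    have "(g(u := x, v := y)) ` e \<in> Q e \<longleftrightarrow> (u \<notin> e \<and> v \<notin> e \<longrightarrow> g ` e \<in> Q e) \<and>
        (u \<in> e \<longrightarrow> (g(u := x)) ` e \<in> Q e) \<and> (v \<in> e \<longrightarrow> (g(v := y)) ` e \<in> Q e)" if eK: "e \<in> K" for e
    proof -
      have nb: "\<not> (u \<in> e \<and> v \<in> e)"
      proof
        assume "u \<in> e \<and> v \<in> e"
        moreover obtain a b where "e = {a, b}" using edge_cases[of e] eK K by blast
        ultimately have "e = {u, v}" using uv(4) by auto
        then show False using eK K uv by simp
      qed
      consider "u \<in> e" "v \<notin> e" | "u \<notin> e" "v \<in> e" | "u \<notin> e" "v \<notin> e" using nb by blast
      then show ?thesis
      proof cases
        case 1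
        then have "(g(u := x, v := y)) ` e = (g(u := x)) ` e" by (intro image_cong) auto
        then show ?thesis using 1 by simp
      next
        case 2
        then have "(g(u := x, v := y)) ` e = (g(v := y)) ` e" by (intro image_cong) auto
        then show ?thesis using 2 by simp
      next
        case 3
        then have "(g(u := x, v := y)) ` e = g ` e" by (intro image_cong) auto
        then show ?thesis using 3 by simp
      qed
    qed
    then show ?thesis unfolding c_def by blast
  qed
  have fAB: "finite (A g)" "finite (B g)" "A g \<subseteq> X u" "B g \<subseteq> X v" for g
    using fX uv by (auto simp: A_def B_def)
  have h1: "homs Q K = (\<Sum>g\<in>?G. if c g then card (A g) * card (B g) else 0)"
    unfolding homs_def card_homs_two[OF uv(2-4)]
  proof (rule sum.cong[OF refl])
    fix g
    have "{(x, y). x \<in> X u \<and> y \<in> X v \<and> (\<forall>e\<in>K. (g(u := x, v := y)) ` e \<in> Q e)} = (if c g then A g \<times> B g else {})"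
      unfolding key by (auto simp: A_def B_def)
    then show "card {(x, y). x \<in> X u \<and> y \<in> X v \<and> (\<forall>e\<in>K. (g(u := x, v := y)) ` e \<in> Q e)} =
        (if c g then card (A g) * card (B g) else 0)"
      by (simp add: card_cartesian_product)
  qed
  have h2: "homs Q (insert e K) = (\<Sum>g\<in>?G. if c g then edge_count (Q e) (A g) (B g) else 0)"
    unfolding homs_def card_homs_two[OF uv(2-4)]
  proof (rule sum.cong[OF refl])
    fix g
    have "{(x, y). x \<in> X u \<and> y \<in> X v \<and> (\<forall>e\<in>insert e K. (g(u := x, v := y)) ` e \<in> Q e)} =
        (if c g then {(x, y). x \<in> A g \<and> y \<in> B g \<and> {x, y} \<in> Q e} else {})"
      unfolding ball_simps key using uv by (auto simp: A_def B_def)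
    then show "card {(x, y). x \<in> X u \<and> y \<in> X v \<and> (\<forall>e\<in>insert e K. (g(u := x, v := y)) ` e \<in> Q e)} =
        (if c g then edge_count (Q e) (A g) (B g) else 0)"
      by (simp add: edge_count_def)
  qed
  let ?b = "\<eta> * (real (card (X u)) * real (card (X v)))"
  have cut': "\<bar>real (edge_count (Q e) A' B') - d * (real (card A') * real (card B'))\<bar> \<le> ?b"
    if "A' \<subseteq> X u" "B' \<subseteq> X v" for A' B'
    using cut uv(1) that unfolding cut_close_def by simp
  \<comment> \<open>The sign of \<eta> is not assumed; the empty sets in \<open>cut_close\<close>
    supply it. It is needed for those \<open>g\<close> that violate \<open>c\<close>.\<close>
  have b0: "0 \<le> ?b" using cut'[of "{}" "{}"] by simp
  have "\<bar>real (homs Q (insert e K)) - d * real (homs Q K)\<bar> =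
      \<bar>\<Sum>g\<in>?G. if c g then real (edge_count (Q e) (A g) (B g)) - d * (real (card (A g)) * real (card (B g))) else 0\<bar>"
    unfolding h1 h2 of_nat_sum sum_distrib_left sum_subtractf[symmetric]
    by (intro arg_cong[where f = abs] sum.cong refl) simp
  also have "\<dots> \<le> (\<Sum>g\<in>?G. \<bar>if c g then real (edge_count (Q e) (A g) (B g)) - d * (real (card (A g)) * real (card (B g))) else 0\<bar>)"
    by (rule sum_abs)
  also have "\<dots> \<le> (\<Sum>g\<in>?G. ?b)"
    using cut'[OF fAB(3,4)] b0 by (intro sum_mono) auto
  also have "\<dots> = \<eta> * \<Pi>X"
    unfolding prod_remove_two[OF finite_VH uv(2-4)] by (simp add: card_PiE_rest)
  finally show ?thesis .
qed

text \<open>Telescoping: the edges of \<open>L\<close> are traded one by one for factors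
  \<open>d e\<close>, each at a cost of \<eta> times the number of all maps, and factors at most 1
  do not amplify earlier errors. The edges in \<open>K - L\<close> may have arbitrary target graphs,
  which is how one bad pair is tolerated.\<close>

lemma homs_diff:
  assumes "finite L" and "K \<subseteq> EH" "L \<subseteq> K" and "\<And>e. e \<in> L \<Longrightarrow> cut_close \<eta> (Q e) (d e) e"
    and "\<And>e. e \<in> L \<Longrightarrow> 0 \<le> d e \<and> d e \<le> 1"
  shows "\<bar>real (homs Q K) - prod d L * real (homs Q (K - L))\<bar> \<le> real (card L) * (\<eta> * \<Pi>X)"
  using assms
proof (induction L arbitrary: K rule: finite_induct)
  case empty
  then show ?case by simp
next
  case (insert e L)
  have d: "0 \<le> d e" "d e \<le> 1" using insert.prems by auto
  have e: "e \<in> EH" "e \<in> K" using insert.prems by auto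
  let ?x = "real (homs Q K)" and ?y = "real (homs Q (K - {e}))" and ?z = "real (homs Q (K - insert e L))"
  have "\<bar>real (homs Q (insert e (K - {e}))) - d e * ?y\<bar> \<le> \<eta> * \<Pi>X"
    by (rule homs_insert) (use insert.prems e in auto)
  then have 1: "\<bar>?x - d e * ?y\<bar> \<le> \<eta> * \<Pi>X" using e by (simp add: insert_absorb)
  have "\<bar>?y - prod d L * real (homs Q (K - {e} - L))\<bar> \<le> real (card L) * (\<eta> * \<Pi>X)"
    by (rule insert.IH) (use insert.prems insert.hyps in auto)
  moreover have "K - {e} - L = K - insert e L" by auto
  ultimately have 2: "\<bar>?y - prod d L * ?z\<bar> \<le> real (card L) * (\<eta> * \<Pi>X)" by simp
  have "\<bar>d e * ?y - d e * (prod d L * ?z)\<bar> = d e * \<bar>?y - prod d L * ?z\<bar>"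
    using d by (simp add: abs_mult flip: right_diff_distrib)
  also have "\<dots> \<le> \<bar>?y - prod d L * ?z\<bar>" using d by (simp add: mult_left_le_one_le)
  finally have "\<bar>?x - d e * (prod d L * ?z)\<bar> \<le> \<eta> * \<Pi>X + real (card L) * (\<eta> * \<Pi>X)"
    using 1 2 by linarith
  moreover have "prod d (insert e L) * ?z = d e * (prod d L * ?z)" using insert.hyps by simp
  moreover have "real (card (insert e L)) * (\<eta> * \<Pi>X) = \<eta> * \<Pi>X + real (card L) * (\<eta> * \<Pi>X)"
    using insert.hyps by (simp add: algebra_simps)
  ultimately show ?case by (simp only:)
qed

text \<open>With a single constraint left the count is exact, so no regularity is required of that
  pair.\<close>

lemma homs_single:
  assumes "u \<in> VH" "v \<in> VH" "u \<noteq> v"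
  shows "real (homs Q {{u, v}}) * (real (card (X u)) * real (card (X v))) = real (edge_count (Q {u, v}) (X u) (X v)) * \<Pi>X"
proof -
  have "homs Q {{u, v}} = (\<Sum>g\<in>PiE (VH - {u, v}) X. edge_count (Q {u, v}) (X u) (X v))"
    unfolding homs_def card_homs_two[OF assms] edge_count_def
    using assms by (intro sum.cong refl arg_cong[where f = card]) auto
  then have "real (homs Q {{u, v}}) = (\<Prod>w\<in>VH - {u, v}. real (card (X w))) * real (edge_count (Q {u, v}) (X u) (X v))"
    by (simp add: card_PiE_rest)
  then show ?thesis unfolding prod_remove_two[OF finite_VH assms] by simp
qed

text \<open>Union bound over pairs of distinct vertices: identifying the images of \<open>u\<close>
  and \<open>v\<close> costs a factor \<open>card (X v)\<close>, which is at least \<mu>.\<close>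

lemma noninjective_count:
  assumes "\<mu> > 0" "\<And>w. w \<in> VH \<Longrightarrow> real (card (X w)) \<ge> \<mu>"
  shows "real (card {f \<in> PiE VH X. \<not> inj_on f VH}) \<le> (real (card VH))\<^sup>2 / \<mu> * \<Pi>X"
proof -
  let ?N = "\<lambda>z. {f \<in> PiE VH X. f (fst z) = f (snd z)}"
  let ?I = "{z \<in> VH \<times> VH. fst z \<noteq> snd z}"
  have fI: "finite ?I" using finite_VH by simp
  have N: "real (card (?N z)) \<le> \<Pi>X / \<mu>" if z: "z \<in> ?I" for z
  proof -
    obtain u v where uv: "z = (u, v)" "u \<in> VH" "v \<in> VH" "u \<noteq> v" using z by (cases z) auto
    have "card {f \<in> PiE VH X. f u = f v} = (\<Sum>g\<in>PiE (VH - {u, v}) X. card {(x, y). x \<in> X u \<and> y \<in> X v \<and> x = y})"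
      unfolding card_homs_two[OF uv(2-4)] using uv by simp
    also have "\<dots> \<le> (\<Sum>g\<in>PiE (VH - {u, v}) X. card (X u))"
    proof (rule sum_mono)
      have "{(x, y). x \<in> X u \<and> y \<in> X v \<and> x = y} \<subseteq> (\<lambda>x. (x, x)) ` X u" by auto
      then show "card {(x, y). x \<in> X u \<and> y \<in> X v \<and> x = y} \<le> card (X u)"
        using fX[OF uv(2)] by (meson card_image_le card_mono finite_imageI le_trans)
    qed
    finally have "card {f \<in> PiE VH X. f u = f v} \<le> card (PiE (VH - {u, v}) X) * card (X u)" by simp
    then have "card (?N z) \<le> card (PiE (VH - {u, v}) X) * card (X u)"
      using uv by simp
    then have "real (card (?N z)) \<le> real (card (PiE (VH - {u, v}) X) * card (X u))"
      by (rule of_nat_mono)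
    also have "\<dots> = (\<Prod>w\<in>VH - {u, v}. real (card (X w))) * real (card (X u))"
      by (simp add: card_PiE_rest)
    finally have "real (card (?N z)) * \<mu> \<le> (\<Prod>w\<in>VH - {u, v}. real (card (X w))) * real (card (X u)) * real (card (X v))"
      using assms uv by (intro mult_mono) (auto intro!: mult_nonneg_nonneg prod_nonneg)
    then have "real (card (?N z)) * \<mu> \<le> \<Pi>X" unfolding prod_remove_two[OF finite_VH uv(2-4)] by (simp add: mult_ac)
    then show ?thesis using assms(1) by (simp add: pos_le_divide_eq)
  qed
  have fN: "finite (PiE VH X)" using finite_VH fX by (intro finite_PiE) auto
  have "{f \<in> PiE VH X. \<not> inj_on f VH} \<subseteq> (\<Union>z\<in>?I. ?N z)" by (auto simp: inj_on_def)
  then have "card {f \<in> PiE VH X. \<not> inj_on f VH} \<le> card (\<Union>z\<in>?I. ?N z)"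
    using fI fN by (intro card_mono) auto
  also have "\<dots> \<le> (\<Sum>z\<in>?I. card (?N z))" by (rule card_UN_le[OF fI])
  finally have "real (card {f \<in> PiE VH X. \<not> inj_on f VH}) \<le> real (\<Sum>z\<in>?I. card (?N z))"
    by (rule of_nat_mono)
  also have "\<dots> = (\<Sum>z\<in>?I. real (card (?N z)))" by (rule of_nat_sum)
  also have "\<dots> \<le> (\<Sum>z\<in>?I. \<Pi>X / \<mu>)" using N by (rule sum_mono)
  also have "\<dots> = real (card ?I) * (\<Pi>X / \<mu>)" by simp
  also have "\<dots> \<le> real (card (VH \<times> VH)) * (\<Pi>X / \<mu>)"
    using finite_VH assms(1) by (intro mult_right_mono of_nat_mono card_mono) (auto intro!: divide_nonneg_pos prod_nonneg)
  also have "\<dots> = (real (card VH))\<^sup>2 / \<mu> * \<Pi>X"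
    by (simp add: card_cartesian_product power2_eq_square)
  finally show ?thesis .
qed

text \<open>In the application \<open>E'\<close> is the edited graph and \<open>E\<close> the graph
  before editing. A map into \<open>E'\<close> is an embedding into \<open>E\<close>, or not
  injective, or sends some edge \<open>e0\<close> into \<open>E' - E\<close>. The last kind makes up
  a fraction \<beta> of the main term \<open>D\<close> for each \<open>e0\<close>, up to regularity
  errors, however small the densities are; this is why a constant \<beta> suffices. Bad edges,
  regularity errors and non-injective maps each cost at most a quarter of the main term, leaving one
  quarter.\<close>

lemma embedding_count:
  fixes E E' :: "nat set set"
  assumes reg: "\<And>u v. {u, v} \<in> EH \<Longrightarrow> regular_pair \<eta> E' (X u) (X v)"
    and dens: "\<And>u v. {u, v} \<in> EH \<Longrightarrow> pair_density E' (X u) (X v) \<ge> \<gamma>"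
    and few: "\<And>u v. {u, v} \<in> EH \<Longrightarrow>
      real (edge_count (E' - E) (X u) (X v)) \<le> \<beta> * real (edge_count E' (X u) (X v))"
    and m: "card EH \<le> m" and \<gamma>: "0 < \<gamma>" "\<gamma> \<le> 1" and "0 \<le> \<eta>" "0 \<le> \<beta>" "real m * \<beta> \<le> 1 / 4"
    and \<eta>: "\<eta> * (real m + (real m)\<^sup>2) \<le> \<gamma> ^ m / 4"
    and \<mu>: "\<mu> > 0" "\<And>w. w \<in> VH \<Longrightarrow> real (card (X w)) \<ge> \<mu>" "(real (card VH))\<^sup>2 / \<mu> \<le> \<gamma> ^ m / 4"
  shows "real (card {f \<in> PiE VH X. inj_on f VH \<and> (\<forall>e\<in>EH. f ` e \<in> E)}) \<ge> \<gamma> ^ m / 4 * \<Pi>X"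
proof -
  define d where "d = (\<lambda>e. pair_density E' (X (Min e)) (X (Max e)))"
    \<comment> \<open>\<open>Min\<close> and \<open>Max\<close> merely select the two endpoints of \<open>e\<close>\<close>
  have d: "d {u, v} = pair_density E' (X u) (X v)" for u v
    unfolding d_def using pair_density_commute by (cases "u \<le> v") (auto simp: min_def max_def)
  have d01: "0 \<le> d e \<and> d e \<le> 1" "d e \<ge> \<gamma>" and cut: "cut_close \<eta> E' (d e) e" if e: "e \<in> EH" for e
  proof -
    obtain u v where uv: "e = {u, v}" "u \<in> VH" "v \<in> VH" using edge_cases[OF e] by metis
    show "0 \<le> d e \<and> d e \<le> 1" unfolding uv d using pair_density_bounds fX uv by auto
    show "d e \<ge> \<gamma>" using dens e unfolding uv d by auto
    show "cut_close \<eta> E' (d e) e"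
      unfolding cut_close_def
    proof (intro allI impI)
      fix u v A B assume e': "e = {u, v}" and AB: "A \<subseteq> X u" "B \<subseteq> X v"
      have "u \<in> VH" "v \<in> VH" using uv e' by (auto simp: doubleton_eq_iff)
      then show "\<bar>real (edge_count E' A B) - d e * (real (card A) * real (card B))\<bar>
          \<le> \<eta> * (real (card (X u)) * real (card (X v)))"
        unfolding e' d by (intro regular_pair_discrepancy reg fX AB \<open>0 \<le> \<eta>\<close>) (use e e' in auto)
    qed
  qed
  define D where "D = prod d EH"
  have \<Pi>0: "\<Pi>X \<ge> 0" by (intro prod_nonneg) auto
  have mm: "real (card EH) \<le> real m" using m by simp
  have \<eta>\<Pi>: "0 \<le> \<eta> * \<Pi>X" using \<open>0 \<le> \<eta>\<close> \<Pi>0 by simp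
  have D: "D \<ge> \<gamma> ^ m"
  proof -
    have "\<gamma> ^ m \<le> \<gamma> ^ card EH" using m \<gamma> by (intro power_decreasing) auto
    also have "\<dots> = (\<Prod>e\<in>EH. \<gamma>)" by simp
    also have "\<dots> \<le> D" unfolding D_def using d01 \<gamma> by (intro prod_mono) auto
    finally show ?thesis .
  qed
  have D0: "D \<ge> 0" using D \<gamma> by (meson order_trans zero_le_power less_imp_le)
  let ?all = "homs (\<lambda>_. E') EH"
  let ?bad = "\<lambda>e0. homs (\<lambda>e. if e = e0 then E' - E else E') EH"
  have all: "real ?all \<ge> D * \<Pi>X - real m * (\<eta> * \<Pi>X)"
  proof -
    have "\<bar>real ?all - prod d EH * real (homs (\<lambda>_. E') (EH - EH))\<bar> \<le> real (card EH) * (\<eta> * \<Pi>X)"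
      by (rule homs_diff) (use finite_EH cut d01 in auto)
    moreover have "real (homs (\<lambda>_. E') (EH - EH)) = \<Pi>X"
      unfolding homs_def using finite_VH by (simp add: card_PiE)
    moreover have "real (card EH) * (\<eta> * \<Pi>X) \<le> real m * (\<eta> * \<Pi>X)"
      using mm \<eta>\<Pi> by (rule mult_right_mono)
    ultimately show ?thesis unfolding D_def by (simp only:)
  qed
  have bad: "real (?bad e0) \<le> \<beta> * D * \<Pi>X + real m * (\<eta> * \<Pi>X)" if e0: "e0 \<in> EH" for e0
  proof -
    let ?Q = "\<lambda>e. if e = e0 then E' - E else E'"
    obtain u v where uv: "e0 = {u, v}" "u \<in> VH" "v \<in> VH" "u \<noteq> v" using edge_cases[OF e0] .
    \<comment> \<open>All edges except \<open>e0\<close> are traded for densities; what remains is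
      the exact count of \<open>homs_single\<close>, to which \<open>few\<close> applies.\<close>
    have "\<bar>real (homs ?Q EH) - prod d (EH - {e0}) * real (homs ?Q (EH - (EH - {e0})))\<bar> \<le> real (card (EH - {e0})) * (\<eta> * \<Pi>X)"
      by (rule homs_diff) (use finite_EH cut d01 in auto)
    moreover have "EH - (EH - {e0}) = {e0}" using e0 by auto
    moreover have "real (card (EH - {e0})) * (\<eta> * \<Pi>X) \<le> real m * (\<eta> * \<Pi>X)"
    proof (rule mult_right_mono[OF _ \<eta>\<Pi>])
      have "card (EH - {e0}) \<le> card EH" by (rule card_mono) (use finite_EH in auto)
      then show "real (card (EH - {e0})) \<le> real m" using m by simp
    qed
    ultimately have 1: "real (?bad e0) \<le> prod d (EH - {e0}) * real (homs ?Q {e0}) + real m * (\<eta> * \<Pi>X)"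
      by (simp only:)
    have c: "real (card (X u)) * real (card (X v)) > 0"
      using \<mu>(1) \<mu>(2)[OF uv(2)] \<mu>(2)[OF uv(3)] by (intro mult_pos_pos) linarith+
    have "real (homs ?Q {e0}) * (real (card (X u)) * real (card (X v))) = real (edge_count (E' - E) (X u) (X v)) * \<Pi>X"
      using homs_single[OF uv(2-4), of ?Q] uv(1) by simp
    also have "\<dots> \<le> (\<beta> * real (edge_count E' (X u) (X v))) * \<Pi>X"
      by (intro mult_right_mono few \<Pi>0) (use e0 uv in auto)
    also have "real (edge_count E' (X u) (X v)) = d e0 * (real (card (X u)) * real (card (X v)))"
      unfolding uv(1) d using c by (intro edge_count_eq_density) (auto simp: zero_less_mult_iff)
    finally have "real (homs ?Q {e0}) * (real (card (X u)) * real (card (X v))) \<le>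
        (\<beta> * d e0 * \<Pi>X) * (real (card (X u)) * real (card (X v)))"
      by (simp only: mult_ac)
    then have "real (homs ?Q {e0}) \<le> \<beta> * d e0 * \<Pi>X" by (rule mult_right_le_imp_le[OF _ c])
    then have "prod d (EH - {e0}) * real (homs ?Q {e0}) \<le> prod d (EH - {e0}) * (\<beta> * d e0 * \<Pi>X)"
      using d01 by (intro mult_left_mono prod_nonneg) auto
    also have "\<dots> = \<beta> * D * \<Pi>X"
      unfolding D_def prod.remove[OF finite_EH e0] by (simp only: mult_ac)
    finally show ?thesis using 1 by linarith
  qed
  let ?good = "{f \<in> PiE VH X. inj_on f VH \<and> (\<forall>e\<in>EH. f ` e \<in> E)}"
  let ?non = "{f \<in> PiE VH X. \<not> inj_on f VH}"
  let ?B = "\<lambda>e0. {f \<in> PiE VH X. \<forall>e\<in>EH. f ` e \<in> (if e = e0 then E' - E else E')}"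
  have fP: "finite (PiE VH X)" using finite_VH fX by (intro finite_PiE) auto
  have "?all \<le> card (?good \<union> ?non \<union> (\<Union>e0\<in>EH. ?B e0))"
    unfolding homs_def
  proof (rule card_mono)
    show "finite (?good \<union> ?non \<union> (\<Union>e0\<in>EH. ?B e0))" using fP finite_EH by simp
    show "{f \<in> PiE VH X. \<forall>e\<in>EH. f ` e \<in> E'} \<subseteq> ?good \<union> ?non \<union> (\<Union>e0\<in>EH. ?B e0)"
      by (auto split: if_splits)
  qed
  also have "\<dots> \<le> card ?good + card ?non + card (\<Union>e0\<in>EH. ?B e0)"
    by (meson card_Un_le add_le_mono1 le_trans)
  also have "card (\<Union>e0\<in>EH. ?B e0) \<le> (\<Sum>e0\<in>EH. ?bad e0)"
    unfolding homs_def by (rule card_UN_le[OF finite_EH])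
  finally have "real ?all \<le> real (card ?good) + real (card ?non) + real (\<Sum>e0\<in>EH. ?bad e0)"
    by linarith
  moreover have "real (\<Sum>e0\<in>EH. ?bad e0) \<le> real m * (\<beta> * D * \<Pi>X + real m * (\<eta> * \<Pi>X))"
  proof -
    have "real (\<Sum>e0\<in>EH. ?bad e0) \<le> (\<Sum>e0\<in>EH. \<beta> * D * \<Pi>X + real m * (\<eta> * \<Pi>X))"
      unfolding of_nat_sum by (intro sum_mono bad)
    also have "\<dots> = real (card EH) * (\<beta> * D * \<Pi>X + real m * (\<eta> * \<Pi>X))" by simp
    also have "\<dots> \<le> real m * (\<beta> * D * \<Pi>X + real m * (\<eta> * \<Pi>X))"
      using mm D0 \<Pi>0 \<eta>\<Pi> \<open>0 \<le> \<beta>\<close> by (intro mult_right_mono) auto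
    finally show ?thesis .
  qed
  moreover have "real (card ?non) \<le> \<gamma> ^ m / 4 * \<Pi>X"
  proof -
    have "real (card ?non) \<le> (real (card VH))\<^sup>2 / \<mu> * \<Pi>X"
      by (rule noninjective_count[OF \<mu>(1,2)])
    also have "\<dots> \<le> \<gamma> ^ m / 4 * \<Pi>X" using \<mu>(3) \<Pi>0 by (rule mult_right_mono)
    finally show ?thesis .
  qed
  ultimately have "real (card ?good) \<ge> D * \<Pi>X - real m * (\<eta> * \<Pi>X)
      - real m * (\<beta> * D * \<Pi>X + real m * (\<eta> * \<Pi>X)) - \<gamma> ^ m / 4 * \<Pi>X"
    using all by linarith
  moreover have "D * \<Pi>X - real m * (\<eta> * \<Pi>X) - real m * (\<beta> * D * \<Pi>X + real m * (\<eta> * \<Pi>X)) =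
      D * \<Pi>X - (real m * \<beta>) * (D * \<Pi>X) - (\<eta> * (real m + (real m)\<^sup>2)) * \<Pi>X"
    by (simp add: algebra_simps power2_eq_square)
  moreover have "(real m * \<beta>) * (D * \<Pi>X) \<le> 1 / 4 * (D * \<Pi>X)"
    using D0 \<Pi>0 by (intro mult_right_mono assms) auto
  moreover have "(\<eta> * (real m + (real m)\<^sup>2)) * \<Pi>X \<le> \<gamma> ^ m / 4 * \<Pi>X"
    using \<eta> \<Pi>0 by (rule mult_right_mono)
  moreover have "\<gamma> ^ m * \<Pi>X \<le> D * \<Pi>X" using D \<Pi>0 by (rule mult_right_mono)
  ultimately show ?thesis by linarith
qed

end

section \<open>Packing, cleaning and the removal lemma\<close>

lemma copies_eq:
  assumes "simple_graph VH EH"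
  shows "copies VH EH V E = card {f \<in> VH \<rightarrow>\<^sub>E V. inj_on f VH \<and> (\<forall>e\<in>EH. f ` e \<in> E)}"
proof -
  have "(\<forall>u\<in>VH. \<forall>v\<in>VH. {u, v} \<in> EH \<longrightarrow> {f u, f v} \<in> E) \<longleftrightarrow> (\<forall>e\<in>EH. f ` e \<in> E)" for f
  proof
    assume L: "\<forall>u\<in>VH. \<forall>v\<in>VH. {u, v} \<in> EH \<longrightarrow> {f u, f v} \<in> E"
    show "\<forall>e\<in>EH. f ` e \<in> E"
    proof
      fix e assume "e \<in> EH"
      moreover obtain u v where "e = {u, v}" "u \<in> VH" "v \<in> VH"
        using simple_graph_edgeE[OF assms \<open>e \<in> EH\<close>] by blast
      ultimately show "f ` e \<in> E" using L by simp
    qed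
  next
    assume R: "\<forall>e\<in>EH. f ` e \<in> E"
    show "\<forall>u\<in>VH. \<forall>v\<in>VH. {u, v} \<in> EH \<longrightarrow> {f u, f v} \<in> E"
    proof (intro ballI impI)
      fix u v assume "{u, v} \<in> EH"
      then show "{f u, f v} \<in> E" using bspec[OF R, of "{u, v}"] by simp
    qed
  qed
  then show ?thesis unfolding copies_def by simp
qed

lemma finite_embeddings:
  assumes "finite VH" "finite V"
  shows "finite {f \<in> VH \<rightarrow>\<^sub>E V. Q f}"
  using assms by (intro finite_subset[OF _ finite_PiE[of VH "\<lambda>_. V"]]) auto

text \<open>The edge set of a maximal family of edge-disjoint copies of \<open>H\<close>.\<close>

lemma packing:
  assumes H: "simple_graph VH EH" "EH \<noteq> {}" and G: "simple_graph V E"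
    and far: "\<forall>F \<subseteq> E. copies VH EH V (E - F) = 0 \<longrightarrow> real (card F) \<ge> x"
  obtains E1 where "E1 \<subseteq> E" "real (card E1) \<ge> x"
    "\<And>F. finite F \<Longrightarrow> card EH * card F < card E1 \<Longrightarrow>
      \<exists>f \<in> VH \<rightarrow>\<^sub>E V. inj_on f VH \<and> (\<forall>e\<in>EH. f ` e \<in> E1 - F)"
proof -
  define emb where "emb = {f \<in> VH \<rightarrow>\<^sub>E V. inj_on f VH \<and> (\<forall>e\<in>EH. f ` e \<in> E)}"
  define K where "K = (\<lambda>f. (\<lambda>e. f ` e) ` EH) ` emb"
  have fE: "finite E" "finite VH" "finite V" "finite EH" using G H simple_graph_finite by auto
  have "finite emb" unfolding emb_def by (rule finite_embeddings[OF fE(2,3)])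
  then have fK: "finite K" by (simp add: K_def)
  have KE: "k \<subseteq> E" "finite k" "card k \<le> card EH" "k \<noteq> {}" if kK: "k \<in> K" for k
  proof -
    obtain f where f: "f \<in> emb" "k = (\<lambda>e. f ` e) ` EH" using kK by (auto simp: K_def)
    show "k \<subseteq> E" using f by (auto simp: emb_def)
    show "finite k" "card k \<le> card EH" "k \<noteq> {}" using f fE H by (auto intro: card_image_le)
  qed
  define packs where "packs = {\<F>. \<F> \<subseteq> K \<and> disjoint \<F>}"
  have pk: "finite packs" "packs \<noteq> {}"
  proof -
    show "finite packs" by (rule finite_subset[of _ "Pow K"]) (use fK in \<open>auto simp: packs_def\<close>)
    have "{} \<in> packs" by (simp add: packs_def)
    then show "packs \<noteq> {}" by blast
  qed
  have "Max (card ` packs) \<in> card ` packs" using pk by (intro Max_in) auto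
  then obtain \<F> where F: "\<F> \<in> packs" "card \<F> = Max (card ` packs)" by auto
  have max: "card \<F>' \<le> card \<F>" if "\<F>' \<in> packs" for \<F>'
    unfolding F(2) using pk(1) that by simp
  have FK: "\<F> \<subseteq> K" and disj: "disjoint \<F>" using F(1) by (auto simp: packs_def)
  have fF: "finite \<F>" using FK fK finite_subset by blast
  define U where "U = \<Union>\<F>"
  have U: "U \<subseteq> E" using FK KE(1) by (auto simp: U_def)
  have none: "copies VH EH V (E - U) = 0"
  proof (rule ccontr)
    assume "copies VH EH V (E - U) \<noteq> 0"
    then have "{f \<in> VH \<rightarrow>\<^sub>E V. inj_on f VH \<and> (\<forall>e\<in>EH. f ` e \<in> E - U)} \<noteq> {}"
      unfolding copies_eq[OF H(1)] by (metis card.empty)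
    then obtain f where f: "f \<in> VH \<rightarrow>\<^sub>E V" "inj_on f VH" "\<forall>e\<in>EH. f ` e \<in> E - U" by blast
    define k where "k = (\<lambda>e. f ` e) ` EH"
    have kK: "k \<in> K" unfolding K_def k_def by (rule imageI) (use f in \<open>simp add: emb_def\<close>)
    have kU: "k \<inter> U = {}" using f(3) by (auto simp: k_def)
    \<comment> \<open>Maximality needs a new member: \<open>k\<close> is disjoint from the union of
      the family and nonempty, because H has an edge.\<close>
    have "k \<notin> \<F>"
    proof
      assume "k \<in> \<F>"
      then have "k \<subseteq> U" by (auto simp: U_def)
      then show False using kU KE(4)[OF kK] by blast
    qed
    moreover have "insert k \<F> \<in> packs"
    proof -
      have "disjoint (insert k \<F>)"
        using disj kU unfolding U_def disjoint_def by blast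
      then show ?thesis using kK FK by (simp add: packs_def)
    qed
    ultimately show False using max[of "insert k \<F>"] fF by simp
  qed
  have cU: "card U \<le> card EH * card \<F>"
  proof -
    have "card (\<Union>k\<in>\<F>. k) \<le> (\<Sum>k\<in>\<F>. card k)" by (rule card_UN_le[OF fF])
    also have "\<dots> \<le> (\<Sum>k\<in>\<F>. card EH)" using KE(3) FK by (intro sum_mono) auto
    finally show ?thesis by (simp add: U_def mult.commute)
  qed
  have hit: "\<exists>f \<in> VH \<rightarrow>\<^sub>E V. inj_on f VH \<and> (\<forall>e\<in>EH. f ` e \<in> U - F)"
    if F: "finite F" "card EH * card F < card U" for F
  proof -
    \<comment> \<open>The union has at most \<open>card EH\<close> edges per copy, so there are more
      copies than elements of \<open>F\<close>; being disjoint, they cannot all be hit.\<close>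
    have "card EH * card F < card EH * card \<F>" using F cU by linarith
    then have lt: "card F < card \<F>" by simp
    have "\<exists>k\<in>\<F>. k \<inter> F = {}"
    proof (rule ccontr)
      assume "\<not> (\<exists>k\<in>\<F>. k \<inter> F = {})"
      then have "\<forall>k\<in>\<F>. \<exists>y. y \<in> k \<inter> F" by blast
      then obtain g where g: "\<forall>k\<in>\<F>. g k \<in> k \<inter> F" by (rule bchoice[THEN exE])
      have "inj_on g \<F>"
      proof (rule inj_onI)
        fix k l assume kl: "k \<in> \<F>" "l \<in> \<F>" "g k = g l"
        then have "g k \<in> k \<inter> l" using g by fastforce
        then show "k = l" using disj kl unfolding disjoint_def by blast
      qed
      moreover have "g ` \<F> \<subseteq> F" using g by blast
      ultimately have "card \<F> \<le> card F" using F(1) by (rule card_inj_on_le)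
      then show False using lt by simp
    qed
    then obtain k where k: "k \<in> \<F>" "k \<inter> F = {}" by blast
    then obtain f where f: "f \<in> emb" "k = (\<lambda>e. f ` e) ` EH" using FK by (auto simp: K_def)
    have "\<forall>e\<in>EH. f ` e \<in> U - F" using k f(2) by (auto simp: U_def)
    then show ?thesis using f(1) unfolding emb_def by blast
  qed
  show ?thesis by (rule that[OF U _ hit]) (use far U none in auto)
qed

section \<open>The cost of discarding edges between parts\<close>

definition between :: "nat set set \<Rightarrow> nat set \<Rightarrow> nat set \<Rightarrow> nat set set" where
  "between E A B = (\<lambda>(u, v). {u, v}) ` {(u, v). u \<in> A \<and> v \<in> B \<and> {u, v} \<in> E}"

text \<open>Only an inequality: an edge inside the intersection of \<open>A\<close> and
  \<open>B\<close> is one element of \<open>between\<close> but two ordered pairs in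
  \<open>edge_count\<close>.\<close>

lemma card_between_le: "finite A \<Longrightarrow> finite B \<Longrightarrow> card (between E A B) \<le> edge_count E A B"
  unfolding between_def edge_count_def by (intro card_image_le finite_edge_pairs)

lemma betweenI: "u \<in> A \<Longrightarrow> v \<in> B \<Longrightarrow> {u, v} \<in> E \<Longrightarrow> {u, v} \<in> between E A B"
  unfolding between_def by (intro image_eqI[of _ _ "(u, v)"]) auto

lemma edge_count_le_twice:
  assumes "simple_graph V E"
  shows "edge_count E V V \<le> 2 * card E"
proof -
  have fE: "finite E" using assms simple_graph_finite by auto
  have c: "finite {(u, v). {u, v} = e} \<and> card {(u, v). {u, v} = e} \<le> 2" if e: "e \<in> E" for e
  proof -
    obtain a b where "e = {a, b}" using simple_graph_edgeE[OF assms e] by blast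
    then have s: "{(u, v). {u, v} = e} \<subseteq> {(a, b), (b, a)}" by (auto simp: doubleton_eq_iff)
    have "card {(u, v). {u, v} = e} \<le> card {(a, b), (b, a)}" by (rule card_mono[OF _ s]) simp
    moreover have "card {(a, b), (b, a)} \<le> 2" using card_length[of "[(a, b), (b, a)]"] by simp
    moreover have "finite {(u, v). {u, v} = e}" by (rule finite_subset[OF s]) simp
    ultimately show ?thesis by linarith
  qed
  have "edge_count E V V \<le> card (\<Union>e\<in>E. {(u, v). {u, v} = e})"
    unfolding edge_count_def using fE c by (intro card_mono) auto
  also have "\<dots> \<le> (\<Sum>e\<in>E. card {(u, v). {u, v} = e})" by (rule card_UN_le[OF fE])
  also have "\<dots> \<le> (\<Sum>e\<in>E. 2)" using c by (intro sum_mono) blast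
  finally show ?thesis by simp
qed

lemma card_edges_UN_le:
  assumes "finite I" "\<And>z. z \<in> I \<Longrightarrow> finite (fst z) \<and> finite (snd z)"
  shows "real (card (\<Union>z\<in>I. between E (fst z) (snd z))) \<le> (\<Sum>z\<in>I. real (edge_count E (fst z) (snd z)))"
proof -
  have "card (\<Union>z\<in>I. between E (fst z) (snd z)) \<le> (\<Sum>z\<in>I. card (between E (fst z) (snd z)))"
    by (rule card_UN_le[OF assms(1)])
  also have "\<dots> \<le> (\<Sum>z\<in>I. edge_count E (fst z) (snd z))"
    using assms(2) by (intro sum_mono card_between_le) auto
  finally have "real (card (\<Union>z\<in>I. between E (fst z) (snd z))) \<le> real (\<Sum>z\<in>I. edge_count E (fst z) (snd z))"
    by (rule of_nat_mono)
  then show ?thesis by (simp only: of_nat_sum)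
qed

lemma low_density_edges:
  assumes P: "partition_on V P" "finite V" and "\<gamma> \<ge> 0"
  shows "real (card (\<Union>z\<in>{z \<in> P \<times> P. pair_density E (fst z) (snd z) < \<gamma>}. between E (fst z) (snd z)))
    \<le> \<gamma> * (real (card V))\<^sup>2"
proof -
  let ?I = "{z \<in> P \<times> P. pair_density E (fst z) (snd z) < \<gamma>}"
  have fP: "finite P" using P finite_elements by blast
  have "real (card (\<Union>z\<in>?I. between E (fst z) (snd z))) \<le> (\<Sum>z\<in>?I. real (edge_count E (fst z) (snd z)))"
    by (rule card_edges_UN_le) (use fP partition_on_finite_part[OF P] in auto)
  also have "\<dots> \<le> (\<Sum>z\<in>?I. \<gamma> * (real (card (fst z)) * real (card (snd z))))"
  proof (rule sum_mono)
    fix z assume z: "z \<in> ?I"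
    then have "card (fst z) > 0" "card (snd z) > 0" using partition_on_finite_part[OF P] by auto
    then have "real (edge_count E (fst z) (snd z)) =
        pair_density E (fst z) (snd z) * (real (card (fst z)) * real (card (snd z)))"
      by (rule edge_count_eq_density)
    also have "\<dots> \<le> \<gamma> * (real (card (fst z)) * real (card (snd z)))"
      using z by (intro mult_right_mono) auto
    finally show "real (edge_count E (fst z) (snd z)) \<le> \<gamma> * (real (card (fst z)) * real (card (snd z)))" .
  qed
  also have "\<dots> \<le> (\<Sum>z\<in>P\<times>P. \<gamma> * (real (card (fst z)) * real (card (snd z))))"
    using fP \<open>\<gamma> \<ge> 0\<close> by (intro sum_mono2) auto
  also have "\<dots> = \<gamma> * (\<Sum>A\<in>P. \<Sum>B\<in>P. real (card A) * real (card B))"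
    by (simp add: sum.cartesian_product case_prod_beta sum_distrib_left)
  also have "\<dots> = \<gamma> * (real (card V))\<^sup>2"
    unfolding sum_card_product[OF P P] by (simp add: power2_eq_square)
  finally show ?thesis .
qed

text \<open>A charging argument: in a corrupted pair the edges of \<open>E\<close> number at most
  1/\<beta> times those of \<open>D\<close>, and over all ordered pairs of parts each edge of
  \<open>D\<close> is counted at most twice.\<close>

lemma corrupted_pair_edges:
  assumes P: "partition_on V P" "finite V" and D: "simple_graph V D" and "\<beta> > 0"
  shows "real (card (\<Union>z\<in>{z \<in> P \<times> P. real (edge_count D (fst z) (snd z)) > \<beta> * real (edge_count E (fst z) (snd z))}.
      between E (fst z) (snd z))) \<le> 2 * real (card D) / \<beta>"
proof -
  let ?I = "{z \<in> P \<times> P. real (edge_count D (fst z) (snd z)) > \<beta> * real (edge_count E (fst z) (snd z))}"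
  have fP: "finite P" using P finite_elements by blast
  have "real (card (\<Union>z\<in>?I. between E (fst z) (snd z))) \<le> (\<Sum>z\<in>?I. real (edge_count E (fst z) (snd z)))"
    by (rule card_edges_UN_le) (use fP partition_on_finite_part[OF P] in auto)
  also have "\<dots> \<le> (\<Sum>z\<in>?I. real (edge_count D (fst z) (snd z)) / \<beta>)"
    using \<open>\<beta> > 0\<close> by (intro sum_mono) (auto simp: pos_le_divide_eq mult.commute)
  also have "\<dots> \<le> (\<Sum>z\<in>P\<times>P. real (edge_count D (fst z) (snd z)) / \<beta>)"
    using fP \<open>\<beta> > 0\<close> by (intro sum_mono2) auto
  also have "\<dots> = (\<Sum>A\<in>P. \<Sum>B\<in>P. real (edge_count D A B)) / \<beta>"
    by (simp add: sum.cartesian_product case_prod_beta sum_divide_distrib)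
  also have "\<dots> = real (edge_count D V V) / \<beta>"
    unfolding edge_count_partition[OF P P] ..
  also have "\<dots> \<le> real (2 * card D) / \<beta>"
    using edge_count_le_twice[OF D] \<open>\<beta> > 0\<close> by (intro divide_right_mono of_nat_mono) auto
  finally show ?thesis by simp
qed

lemma inside_edges:
  assumes P: "partition_on V P" "finite V" and c: "\<And>A. A \<in> P \<Longrightarrow> real (card A) \<le> c"
  shows "real (card (\<Union>A\<in>P. between E A A)) \<le> c * real (card V)"
proof -
  have fP: "finite P" using P finite_elements by blast
  have "card (\<Union>A\<in>P. between E A A) \<le> (\<Sum>A\<in>P. card (between E A A))" by (rule card_UN_le[OF fP])
  also have "\<dots> \<le> (\<Sum>A\<in>P. card A * card A)"
  proof (rule sum_mono)
    fix A assume "A \<in> P"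
    then have "finite A" using partition_on_finite_part[OF P] by blast
    then show "card (between E A A) \<le> card A * card A"
      using card_between_le edge_count_le le_trans by meson
  qed
  finally have "real (card (\<Union>A\<in>P. between E A A)) \<le> real (\<Sum>A\<in>P. card A * card A)" by (rule of_nat_mono)
  also have "\<dots> = (\<Sum>A\<in>P. real (card A) * real (card A))" by simp
  also have "\<dots> \<le> (\<Sum>A\<in>P. c * real (card A))" using c by (intro sum_mono mult_right_mono) auto
  also have "\<dots> = c * real (card V)"
    unfolding partition_on_card[OF P] by (simp add: sum_distrib_left)
  finally show ?thesis .
qed

lemma irregular_edges:
  assumes P: "regular_equipartition \<eta> V E P" "finite V" and c: "\<And>A. A \<in> P \<Longrightarrow> real (card A) \<le> c"
  shows "real (card (\<Union>z\<in>irregular_pairs \<eta> E P. between E (fst z) (snd z))) \<le> \<eta> * (c * real (card P))\<^sup>2"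
proof -
  have p: "partition_on V P" using P by (simp add: regular_equipartition_def equipartition_def)
  have fP: "finite P" using p P finite_elements by blast
  let ?U = "{{A, B} | A B. A \<in> P \<and> B \<in> P \<and> A \<noteq> B \<and> \<not> regular_pair \<eta> E A B}"
  \<comment> \<open>The bound on irregular pairs concerns sets \<open>{A, B}\<close>, so the edges
    are collected by a function of the unordered pair.\<close>
  define bt where "bt = (\<lambda>X. {e. \<exists>A B. X = {A, B} \<and> e \<in> between E A B})"
  have sym: "between E A B = between E B A" for A B
  proof -
    have "between E A B \<subseteq> between E B A" for A B
    proof
      fix e assume "e \<in> between E A B"
      then obtain u v where "e = {u, v}" "u \<in> A" "v \<in> B" "{u, v} \<in> E" by (auto simp: between_def)
      then show "e \<in> between E B A" using betweenI[of v B u A E] by (simp add: insert_commute)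
    qed
    then show ?thesis by blast
  qed
  have bt: "bt {A, B} = between E A B" for A B
    unfolding bt_def using sym by (auto simp: doubleton_eq_iff)
  have fU: "finite ?U"
    by (rule finite_subset[of _ "Pow P"]) (use fP in auto)
  have fA: "finite A" if "A \<in> P" for A using partition_on_finite_part[OF p P(2) that] by blast
  have cb: "finite (bt X) \<and> real (card (bt X)) \<le> c\<^sup>2" if X: "X \<in> ?U" for X
  proof -
    obtain A B where AB: "X = {A, B}" "A \<in> P" "B \<in> P" using X by blast
    have "card (between E A B) \<le> card A * card B"
      using card_between_le edge_count_le fA AB le_trans by meson
    then have "real (card (between E A B)) \<le> real (card A * card B)" by (rule of_nat_mono)
    also have "\<dots> \<le> c * c" using c[OF AB(2)] c[OF AB(3)] by (simp add: mult_mono)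
    finally show ?thesis
      unfolding AB bt using fA[OF AB(2)] fA[OF AB(3)]
      by (auto simp: power2_eq_square between_def intro: finite_edge_pairs)
  qed
  have "(\<Union>z\<in>irregular_pairs \<eta> E P. between E (fst z) (snd z)) \<subseteq> (\<Union>X\<in>?U. bt X)"
  proof
    fix e assume "e \<in> (\<Union>z\<in>irregular_pairs \<eta> E P. between E (fst z) (snd z))"
    then obtain A B where "(A, B) \<in> irregular_pairs \<eta> E P" "e \<in> between E A B" by auto
    then have "{A, B} \<in> ?U" "e \<in> bt {A, B}" unfolding bt by (auto simp: irregular_pairs_def)
    then show "e \<in> (\<Union>X\<in>?U. bt X)" by (rule UN_I)
  qed
  then have "card (\<Union>z\<in>irregular_pairs \<eta> E P. between E (fst z) (snd z)) \<le> card (\<Union>X\<in>?U. bt X)"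
    using fU cb by (intro card_mono finite_UN_I) auto
  also have "\<dots> \<le> (\<Sum>X\<in>?U. card (bt X))" by (rule card_UN_le[OF fU])
  finally have "real (card (\<Union>z\<in>irregular_pairs \<eta> E P. between E (fst z) (snd z))) \<le> real (\<Sum>X\<in>?U. card (bt X))"
    by (rule of_nat_mono)
  also have "\<dots> = (\<Sum>X\<in>?U. real (card (bt X)))" by (rule of_nat_sum)
  also have "\<dots> \<le> (\<Sum>X\<in>?U. c\<^sup>2)" using cb by (intro sum_mono) blast
  also have "\<dots> = real (card ?U) * c\<^sup>2" by simp
  also have "\<dots> \<le> (\<eta> * (real (card P))\<^sup>2) * c\<^sup>2"
    using P(1) by (intro mult_right_mono) (auto simp: regular_equipartition_def)
  finally show ?thesis by (simp add: power_mult_distrib mult_ac)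
qed

text \<open>The bounds on \<eta>, on the order of \<open>P\<close>, on the density and on the edits
  are chosen so that each of five discarded classes has at most card E1 / (8M) edges. A copy of H in
  \<open>E1\<close> avoiding them exists by \<open>hit\<close>, and \<open>X w\<close> is the part
  containing the image of \<open>w\<close>. Vertices that are not adjacent in H may share a
  part.\<close>

lemma reduced_embedding:
  fixes M :: nat
  assumes H: "simple_graph VH EH" "card EH \<le> M" "M > 0"
    and E1: "simple_graph V E1" and E': "simple_graph V E'" and P: "regular_equipartition \<eta> V E' P"
    and "V \<noteq> {}" "eps > 0" and dense: "eps * (real (card V))\<^sup>2 \<le> real (card E1)"
    and diff: "real (card ((E1 - E') \<union> (E' - E1))) \<le> 1 / (64 * (real M)\<^sup>2) * real (card E1)"
    and "0 \<le> \<eta>" "\<eta> \<le> eps / (32 * real M)" and cP: "16 * real M / eps \<le> real (card P)"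
    and hit: "\<And>F. finite F \<Longrightarrow> card EH * card F < card E1 \<Longrightarrow>
      \<exists>f \<in> VH \<rightarrow>\<^sub>E V. inj_on f VH \<and> (\<forall>e\<in>EH. f ` e \<in> E1 - F)"
  obtains X where "\<And>w. w \<in> VH \<Longrightarrow> X w \<in> P"
    "\<And>u v. {u, v} \<in> EH \<Longrightarrow> regular_pair \<eta> E' (X u) (X v) \<and> pair_density E' (X u) (X v) \<ge> eps / (8 * real M) \<and>
       real (edge_count (E' - E1) (X u) (X v)) \<le> 1 / (4 * real M) * real (edge_count E' (X u) (X v))"
proof -
  define \<beta> where "\<beta> = 1 / (4 * real M)"
  define \<gamma> where "\<gamma> = eps / (8 * real M)"
  define n where "n = real (card V)"
  define m1 where "m1 = real (card E1)"
  have M: "real M \<ge> 1" using H(3) by simp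
  have fV: "finite V" and fE1: "finite E1" and fE': "finite E'"
    using simple_graph_finite E1 E' by auto
  have eq: "equipartition V P" using P by (simp add: regular_equipartition_def)
  have p: "partition_on V P" using eq by (simp add: equipartition_def)
  have neP: "P \<noteq> {}" using partition_onD1[OF p] \<open>V \<noteq> {}\<close> by auto
  have fP: "finite P" using p fV finite_elements by blast
  have kP: "real (card P) > 0" using fP neP by (simp add: card_gt_0_iff)
  have n: "n > 0" using fV \<open>V \<noteq> {}\<close> by (simp add: n_def card_gt_0_iff)
  have m1: "m1 > 0" "n\<^sup>2 \<le> m1 / eps"
  proof -
    have "0 < eps * n\<^sup>2" using n \<open>eps > 0\<close> by simp
    then show "m1 > 0" using dense by (simp add: m1_def n_def)
    show "n\<^sup>2 \<le> m1 / eps" using dense \<open>eps > 0\<close> by (simp add: m1_def n_def pos_le_divide_eq mult.commute)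
  qed
  \<comment> \<open>Upper bound for part sizes: a part has at most a + 1 <= 2a elements, where
    \<open>a\<close> is the least size and a |P| <= n.\<close>
  define c where "c = 2 * n / real (card P)"
  have c: "real (card A) \<le> c" if A: "A \<in> P" for A
  proof -
    define a where "a = Min (card ` P)"
    have a: "a > 0" "card A \<le> a + 1" "card P * a \<le> card V"
      using equipartition_card_bounds[OF eq fV neP A] by (simp_all add: a_def)
    have "card P * card A \<le> card P * (2 * a)" using a by (intro mult_left_mono) auto
    then have "card P * card A \<le> 2 * card V" using a(3) by linarith
    then have "real (card P * card A) \<le> real (2 * card V)" by (rule of_nat_mono)
    then have "real (card A) * real (card P) \<le> 2 * n" by (simp add: n_def mult.commute)
    then show ?thesis unfolding c_def using kP by (simp add: pos_le_divide_eq)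
  qed
  \<comment> \<open>Except for \<open>F1\<close>, the classes consist of edges of \<open>E'\<close>
    and may leave \<open>E1\<close>. This is harmless, as \<open>hit\<close> accepts every finite
    set. Once \<open>F1\<close> is avoided, an edge of \<open>E1\<close> is also an edge of
    \<open>E'\<close>.\<close>
  define F1 F2 F3 F4 F5 where "F1 = E1 - E'" and "F2 = (\<Union>A\<in>P. between E' A A)"
    and "F3 = (\<Union>z\<in>irregular_pairs \<eta> E' P. between E' (fst z) (snd z))"
    and "F4 = (\<Union>z\<in>{z \<in> P \<times> P. pair_density E' (fst z) (snd z) < \<gamma>}. between E' (fst z) (snd z))"
    and "F5 = (\<Union>z\<in>{z \<in> P \<times> P. real (edge_count (E' - E1) (fst z) (snd z)) > \<beta> * real (edge_count E' (fst z) (snd z))}.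
      between E' (fst z) (snd z))"
  define F where "F = F1 \<union> F2 \<union> F3 \<union> F4 \<union> F5"
  let ?t = "m1 / (8 * real M)"
  have card_diff: "real (card (E1 - E')) \<le> 1 / (64 * (real M)\<^sup>2) * m1"
    "real (card (E' - E1)) \<le> 1 / (64 * (real M)\<^sup>2) * m1"
  proof -
    have "card (E1 - E') \<le> card ((E1 - E') \<union> (E' - E1))" "card (E' - E1) \<le> card ((E1 - E') \<union> (E' - E1))"
      using fE1 fE' by (auto intro: card_mono)
    then show "real (card (E1 - E')) \<le> 1 / (64 * (real M)\<^sup>2) * m1"
      "real (card (E' - E1)) \<le> 1 / (64 * (real M)\<^sup>2) * m1"
      using diff unfolding m1_def by linarith+
  qed
  have F1: "real (card F1) \<le> ?t"
  proof -
    have "1 / (64 * (real M)\<^sup>2) \<le> 1 / (8 * real M)"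
      using M by (intro divide_left_mono) (auto simp: power2_eq_square)
    then have "1 / (64 * (real M)\<^sup>2) * m1 \<le> 1 / (8 * real M) * m1"
      using m1 by (intro mult_right_mono) auto
    then show ?thesis using card_diff(1) by (simp add: F1_def)
  qed
  have F2: "real (card F2) \<le> ?t"
  proof -
    have "real (card F2) \<le> c * n" unfolding F2_def n_def by (rule inside_edges[OF p fV c])
    also have "\<dots> = 2 * n\<^sup>2 / real (card P)" by (simp add: c_def power2_eq_square)
    also have "\<dots> \<le> 2 * n\<^sup>2 / (16 * real M / eps)"
      using cP kP M \<open>eps > 0\<close> by (intro divide_left_mono) auto
    also have "\<dots> = (eps * n\<^sup>2) / (8 * real M)" using \<open>eps > 0\<close> by simp
    also have "\<dots> \<le> ?t" using dense M by (intro divide_right_mono) (auto simp: n_def m1_def)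
    finally show ?thesis .
  qed
  have F3: "real (card F3) \<le> ?t"
  proof -
    have "real (card F3) \<le> \<eta> * (c * real (card P))\<^sup>2"
      unfolding F3_def by (rule irregular_edges[OF P fV c])
    also have "\<dots> = \<eta> * (4 * n\<^sup>2)" using kP by (simp add: c_def power2_eq_square)
    also have "\<dots> \<le> eps / (32 * real M) * (4 * n\<^sup>2)" using assms by (intro mult_right_mono) auto
    also have "\<dots> = (eps * n\<^sup>2) / (8 * real M)" by simp
    also have "\<dots> \<le> ?t" using dense M by (intro divide_right_mono) (auto simp: n_def m1_def)
    finally show ?thesis .
  qed
  have F4: "real (card F4) \<le> ?t"
  proof -
    have "real (card F4) \<le> \<gamma> * n\<^sup>2"
      unfolding F4_def n_def by (rule low_density_edges[OF p fV]) (use \<open>eps > 0\<close> in \<open>simp add: \<gamma>_def\<close>)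
    also have "\<dots> = (eps * n\<^sup>2) / (8 * real M)" by (simp add: \<gamma>_def)
    also have "\<dots> \<le> ?t" using dense M by (intro divide_right_mono) (auto simp: n_def m1_def)
    finally show ?thesis .
  qed
  have F5: "real (card F5) \<le> ?t"
  proof -
    have "simple_graph V (E' - E1)" by (rule simple_graph_subset[OF E']) auto
    then have "real (card F5) \<le> 2 * real (card (E' - E1)) / \<beta>"
      unfolding F5_def by (rule corrupted_pair_edges[OF p fV]) (use M in \<open>simp add: \<beta>_def\<close>)
    also have "\<dots> \<le> 2 * (1 / (64 * (real M)\<^sup>2) * m1) / \<beta>"
      using card_diff(2) M by (intro divide_right_mono mult_left_mono) (auto simp: \<beta>_def)
    also have "\<dots> = ?t" using M by (simp add: \<beta>_def power2_eq_square)
    finally show ?thesis .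
  qed
  have "between E' A B \<subseteq> E'" for A B by (auto simp: between_def)
  then have "F \<subseteq> E1 \<union> E'"
    unfolding F_def F1_def F2_def F3_def F4_def F5_def by blast
  then have fF: "finite F" using fE1 fE' by (meson finite_UnI finite_subset)
  have "card F \<le> card F1 + card F2 + card F3 + card F4 + card F5"
    unfolding F_def by (intro order_trans[OF card_Un_le] add_mono le_refl)
  then have "real (card F) \<le> 5 * ?t" using F1 F2 F3 F4 F5 by linarith
  then have "real M * real (card F) \<le> real M * (5 * ?t)" using M by (intro mult_left_mono) auto
  \<comment> \<open>Five of the eight shares of the budget are spent, so a copy is left.\<close>
  also have "\<dots> = 5 / 8 * m1" using M by simp
  also have "\<dots> < m1" using m1 by simp
  finally have "real (M * card F) < real (card E1)" by (simp add: m1_def)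
  then have "M * card F < card E1" by (rule of_nat_less_imp_less)
  moreover have "card EH * card F \<le> M * card F" using H(2) by (rule mult_right_mono) simp
  ultimately have "card EH * card F < card E1" by linarith
  then obtain f where f: "f \<in> VH \<rightarrow>\<^sub>E V" "\<forall>e\<in>EH. f ` e \<in> E1 - F"
    using hit[OF fF] by blast
  have "\<exists>A. A \<in> P \<and> x \<in> A" if "x \<in> V" for x using that partition_onD1[OF p] by auto
  then obtain cl where cl: "cl x \<in> P" "x \<in> cl x" if "x \<in> V" for x by metis
  define X where "X = (\<lambda>w. cl (f w))"
  show ?thesis
  proof (rule that[of X])
    show "X w \<in> P" if "w \<in> VH" for w
      unfolding X_def using cl(1) PiE_mem[OF f(1) that] .
    fix u v assume uv: "{u, v} \<in> EH"
    then have uvV: "u \<in> VH" "v \<in> VH"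
      using simple_graph_edgeE[OF H(1) uv] by (auto simp: doubleton_eq_iff)
    then have XP: "X u \<in> P" "X v \<in> P" "f u \<in> X u" "f v \<in> X v"
      unfolding X_def using cl PiE_mem[OF f(1)] by auto
    have e: "{f u, f v} \<in> E1" "{f u, f v} \<notin> F" using bspec[OF f(2) uv] by auto
    have e': "{f u, f v} \<in> E'" using e by (auto simp: F_def F1_def)
    have bt: "{f u, f v} \<in> between E' (X u) (X v)" using XP e' by (intro betweenI)
    have ne: "X u \<noteq> X v"
    proof
      assume "X u = X v"
      then have "{f u, f v} \<in> F2" unfolding F2_def using bt XP(1) by auto
      then show False using e(2) by (simp add: F_def)
    qed
    have notin: "{f u, f v} \<notin> F3" "{f u, f v} \<notin> F4" "{f u, f v} \<notin> F5" using e(2) by (auto simp: F_def)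
    have in_UN: "{f u, f v} \<in> (\<Union>z\<in>I. between E' (fst z) (snd z))" if "(X u, X v) \<in> I" for I
      using UN_I[OF that, of _ "\<lambda>z. between E' (fst z) (snd z)"] bt by simp
    have "regular_pair \<eta> E' (X u) (X v)"
    proof (rule ccontr)
      assume "\<not> regular_pair \<eta> E' (X u) (X v)"
      then have "(X u, X v) \<in> irregular_pairs \<eta> E' P" using XP ne by (simp add: irregular_pairs_def)
      then show False using in_UN notin(1) unfolding F3_def by blast
    qed
    moreover have "pair_density E' (X u) (X v) \<ge> eps / (8 * real M)"
    proof (rule ccontr)
      assume "\<not> pair_density E' (X u) (X v) \<ge> eps / (8 * real M)"
      then have "(X u, X v) \<in> {z \<in> P \<times> P. pair_density E' (fst z) (snd z) < \<gamma>}" using XP by (simp add: \<gamma>_def)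
      then show False using in_UN notin(2) unfolding F4_def by blast
    qed
    moreover have "real (edge_count (E' - E1) (X u) (X v)) \<le> 1 / (4 * real M) * real (edge_count E' (X u) (X v))"
    proof (rule ccontr)
      assume "\<not> real (edge_count (E' - E1) (X u) (X v)) \<le> 1 / (4 * real M) * real (edge_count E' (X u) (X v))"
      then have "(X u, X v) \<in> {z \<in> P \<times> P. real (edge_count (E' - E1) (fst z) (snd z)) > \<beta> * real (edge_count E' (fst z) (snd z))}"
        using XP by (simp add: \<beta>_def)
      then show False using in_UN notin(3) unfolding F5_def by blast
    qed
    ultimately show "regular_pair \<eta> E' (X u) (X v) \<and> pair_density E' (X u) (X v) \<ge> eps / (8 * real M) \<and>
       real (edge_count (E' - E1) (X u) (X v)) \<le> 1 / (4 * real M) * real (edge_count E' (X u) (X v))"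
      by blast
  qed
qed

section \<open>Absorbing polynomial losses into powers of \<open>S_reg\<close>\<close>

lemma S_reg_lower:
  assumes "0 < eps" "eps \<le> 1 / 2" "delta \<ge> 0" "p \<le> 1 / 2"
  obtains k where "k \<ge> 2" "real k \<le> 1 / eps ^ Suc l" "(1 / eps) ^ l \<le> real k"
    "k \<le> S_reg (eps ^ Suc l) delta p"
proof -
  define z where "z = 1 / eps"
  \<comment> \<open>The largest order allowed for an initial partition. It serves as that order and
    as a lower bound for \<open>S_reg\<close>. As z >= 2, rounding down costs less than one factor
    \<open>z\<close>.\<close>
  define k where "k = nat \<lfloor>z ^ Suc l\<rfloor>"
  have z: "z \<ge> 2" using assms by (simp add: z_def pos_le_divide_eq)
  have zl: "z ^ l \<ge> 1" using z by (simp add: one_le_power)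
  have zS: "z ^ Suc l \<ge> 2 * z ^ l" using z zl by (simp add: mult_right_mono)
  have pow: "1 / eps ^ Suc l = z ^ Suc l" by (simp add: z_def power_one_over)
  have k1: "real k \<le> z ^ Suc l" using z by (simp add: k_def)
  have k2: "real k > z ^ Suc l - 1" using z by (simp add: k_def)
  have k3: "z ^ l \<le> real k" using k2 zS zl by linarith
  have k4: "k \<ge> 2"
  proof -
    have "real k > 1" using k2 zS zl by linarith
    then show ?thesis by simp
  qed
  show ?thesis
  proof (rule that[OF k4])
    show "real k \<le> 1 / eps ^ Suc l" using k1 pow by simp
    then show "k \<le> S_reg (eps ^ Suc l) delta p"
      by (intro S_reg_ge) (use assms k4 in auto)
    show "(1 / eps) ^ l \<le> real k" using k3 by (simp add: z_def)
  qed
qed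

lemma refinement_card:
  assumes P: "partition_on V P" and Q: "partition_on V Q" and ref: "refines Q P" and "finite Q"
  shows "card P \<le> card Q"
proof -
  have "\<forall>Z\<in>Q. \<exists>W. W \<in> P \<and> Z \<subseteq> W" using ref unfolding Defs.refines_def by blast
  then obtain g where g: "\<forall>Z\<in>Q. g Z \<in> P \<and> Z \<subseteq> g Z" by (rule bchoice[THEN exE])
  have "P \<subseteq> g ` Q"
  proof
    fix W assume W: "W \<in> P"
    then obtain x where x: "x \<in> W" using partition_onD3[OF P] by fastforce
    then have "x \<in> V" using W partition_onD1[OF P] by blast
    then obtain Z where Z: "Z \<in> Q" "x \<in> Z" using partition_onD1[OF Q] by blast
    then have "g Z \<in> P" "x \<in> g Z" using g by auto
    then have "g Z = W" using W x partition_onD2[OF P] unfolding disjoint_def by blast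
    then show "W \<in> g ` Q" using Z(1) by blast
  qed
  then show ?thesis using \<open>finite Q\<close> by (meson card_image_le card_mono finite_imageI le_trans)
qed

lemma card_edges_le:
  assumes "simple_graph V E"
  shows "card E \<le> (card V)\<^sup>2"
proof -
  have f: "finite V" using assms simple_graph_finite by auto
  have "E \<subseteq> (\<lambda>(u, v). {u, v}) ` (V \<times> V)"
  proof
    fix e assume "e \<in> E"
    then obtain u v where "e = {u, v}" "u \<in> V" "v \<in> V" by (rule simple_graph_edgeE[OF assms])
    then show "e \<in> (\<lambda>(u, v). {u, v}) ` (V \<times> V)" by (intro image_eqI[of _ _ "(u, v)"]) auto
  qed
  then have "card E \<le> card ((\<lambda>(u, v). {u, v}) ` (V \<times> V))" using f by (intro card_mono) auto
  also have "\<dots> \<le> card (V \<times> V)" using f by (intro card_image_le) auto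
  finally show ?thesis by (simp add: card_cartesian_product power2_eq_square)
qed

text \<open>Too few vertices, or parts too small for injective maps, give n <= S^2; there a single
  copy suffices, since 2h <= 2M+3. In the remaining case the parts given by
  \<open>reduced_embedding\<close> are fed into \<open>embedding_count\<close>. An edgeless H is
  treated apart because it has no packing.\<close>

lemma far_graph_copies:
  fixes h :: nat and VH :: "nat set"
  defines "M \<equiv> h\<^sup>2"
  assumes "h \<ge> 3" and H: "simple_graph VH EH" "card VH = h" and eps: "0 < eps" "eps \<le> 1 / (32 * real M)"
    and G: "simple_graph V E"
    and far: "\<forall>F \<subseteq> E. copies VH EH V (E - F) = 0 \<longrightarrow> real (card F) \<ge> eps * (real (card V))\<^sup>2"
  shows "real (card V) ^ h \<le> real (S_reg (eps ^ (2 * M + 3)) (1 / (64 * (real M)\<^sup>2)) eps) ^ (2 * M + 3) * real (copies VH EH V E)"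
proof -
  define \<eta> where "\<eta> = eps ^ (2 * M + 3)"
  define \<delta> where "\<delta> = 1 / (64 * (real M)\<^sup>2)"
  define S where "S = S_reg \<eta> \<delta> eps"
  define z where "z = 1 / eps"
  define n where "n = card V"
  define N where "N = copies VH EH V E"
  have "3 * 3 \<le> h * h" using \<open>h \<ge> 3\<close> by (intro mult_mono) auto
  then have M9: "M \<ge> 9" by (simp add: M_def power2_eq_square)
  have "h \<le> M" by (simp add: M_def power2_eq_square)
  then have hM: "2 * h + 1 \<le> 2 * M + 3" "h \<le> M" by simp_all
  have z: "z \<ge> 32 * real M" "z \<ge> 2" "eps * z = 1" "eps = 1 / z"
  proof -
    show "eps * z = 1" "eps = 1 / z" using eps by (auto simp: z_def)
    have "32 * real M * eps \<le> 1" using eps M9 by (simp add: pos_le_divide_eq mult.commute)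
    then show "z \<ge> 32 * real M" using eps by (simp add: z_def pos_le_divide_eq)
    then show "z \<ge> 2" using M9 by linarith
  qed
  have zpow: "z ^ i \<le> z ^ j" if "i \<le> j" for i j using that z by (intro power_increasing) auto
  have eps_half: "eps \<le> 1 / 2" using z(2) eps by (simp add: z(4) divide_simps)
  have \<delta>0: "\<delta> \<ge> 0" by (simp add: \<delta>_def)
  have suc: "2 * M + 3 = Suc (2 * M + 2)" by simp
  obtain k where k: "k \<ge> 2" "real k \<le> 1 / \<eta>" "z ^ (2 * M + 2) \<le> real k" "k \<le> S"
    using S_reg_lower[OF eps(1) eps_half \<delta>0 eps_half, of "2 * M + 2"] unfolding S_def \<eta>_def z_def suc
    by blast
  have \<eta>0: "\<eta> > 0" using eps by (simp add: \<eta>_def)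
  have \<eta>z: "\<eta> = 1 / z ^ (2 * M + 3)" using z(4) by (simp add: \<eta>_def power_one_over)
  have Sz: "z ^ (2 * M + 2) \<le> real S" using k by linarith
  have S1: "real S \<ge> 1" "real S \<ge> 2" using k by auto
  have Spow: "real S ^ i \<le> real S ^ j" if "i \<le> j" for i j using that S1 by (intro power_increasing) auto
  have fin: "finite V" "finite E" "finite VH" "finite EH" using G H simple_graph_finite by auto
  have goal: "real n ^ h \<le> real S ^ (2 * M + 3) * real N"
  proof (cases "N = 0")
    case True
    \<comment> \<open>Without copies, deleting the empty set makes the graph H-free, so being far
      forces \<open>n = 0\<close>.\<close>
    then have "copies VH EH V (E - {}) = 0" by (simp add: N_def)
    then have "eps * (real n)\<^sup>2 \<le> 0" using far unfolding n_def by (metis card.empty empty_subsetI of_nat_0)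
    then have "n = 0" using eps by (simp add: mult_le_0_iff)
    then show ?thesis using \<open>h \<ge> 3\<close> by (simp add: power_0_left)
  next
    case False
    then have N1: "real N \<ge> 1" by simp
    have small: ?thesis if "real n ^ h \<le> real S ^ (2 * M + 3)"
    proof -
      have "real n ^ h \<le> real S ^ (2 * M + 3) * 1" using that by simp
      also have "\<dots> \<le> real S ^ (2 * M + 3) * real N" using N1 by (intro mult_left_mono) auto
      finally show ?thesis .
    qed
    show ?thesis
    proof (cases "EH = {}")
      \<comment> \<open>The copies are all injective maps; for n >= 2M at least half of all maps are
        injective, by \<open>noninjective_count\<close> with every \<open>X w\<close> equal to
        \<open>V\<close>.\<close>
      case True
      show ?thesis
      proof (cases "n \<le> S")
        case True
        then have "real n ^ h \<le> real S ^ h" by (intro power_mono) auto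
        also have "\<dots> \<le> real S ^ (2 * M + 3)" by (rule Spow) (use hM in auto)
        finally show ?thesis by (rule small)
      next
        case nS: False
        have "z \<le> z ^ (2 * M + 2)" using zpow[of 1 "2 * M + 2"] by simp
        then have nM: "real n \<ge> 2 * real M" "real n > 0" using nS Sz z M9 by linarith+
        have N_eq: "N = card {f \<in> VH \<rightarrow>\<^sub>E V. inj_on f VH}"
          unfolding N_def copies_eq[OF H(1)] using True by simp
        have fP: "finite (VH \<rightarrow>\<^sub>E V)" using fin by (intro finite_PiE) auto
        have "card (VH \<rightarrow>\<^sub>E V) = card ({f \<in> VH \<rightarrow>\<^sub>E V. inj_on f VH} \<union> {f \<in> VH \<rightarrow>\<^sub>E V. \<not> inj_on f VH})"
          by (rule arg_cong[where f = card]) blast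
        also have "\<dots> \<le> N + card {f \<in> VH \<rightarrow>\<^sub>E V. \<not> inj_on f VH}"
          unfolding N_eq by (rule card_Un_le)
        finally have "card (VH \<rightarrow>\<^sub>E V) \<le> N + card {f \<in> VH \<rightarrow>\<^sub>E V. \<not> inj_on f VH}" .
        moreover have "card (VH \<rightarrow>\<^sub>E V) = n ^ h" using fin H(2) by (simp add: card_PiE n_def)
        ultimately have "real (n ^ h) \<le> real (N + card {f \<in> VH \<rightarrow>\<^sub>E V. \<not> inj_on f VH})"
          by (simp only: of_nat_le_iff)
        then have 1: "real n ^ h \<le> real N + real (card {f \<in> VH \<rightarrow>\<^sub>E V. \<not> inj_on f VH})" by simp
        have "real (card {f \<in> VH \<rightarrow>\<^sub>E V. \<not> inj_on f VH}) \<le> (real (card VH))\<^sup>2 / real n * (\<Prod>w\<in>VH. real (card V))"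
          by (rule noninjective_count[OF H(1)]) (use fin nM in \<open>auto simp: n_def\<close>)
        also have "\<dots> = real M / real n * real n ^ h" using H(2) by (simp add: M_def n_def)
        also have "\<dots> \<le> 1 / 2 * real n ^ h"
          using nM by (intro mult_right_mono) (auto simp: pos_divide_le_eq)
        finally have "real n ^ h \<le> 2 * real N" using 1 by linarith
        also have "\<dots> \<le> real S ^ (2 * M + 3) * real N"
        proof (rule mult_right_mono)
          have "real S ^ 1 \<le> real S ^ (2 * M + 3)" by (rule Spow) simp
          then show "2 \<le> real S ^ (2 * M + 3)" using S1 by (simp only: power_one_right)
        qed simp
        finally show ?thesis .
      qed
    next
      case EH: False
      define \<gamma> where "\<gamma> = eps / (8 * real M)"
      \<comment> \<open>Chosen to make h^2 / \<mu> equal to \<gamma>^M / 4, the share conceded to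
        non-injective maps.\<close>
      define \<mu> where "\<mu> = 4 * real M / \<gamma> ^ M"
      have \<gamma>: "0 < \<gamma>" "1 / \<gamma> \<le> z\<^sup>2" "\<gamma> \<le> 1"
      proof -
        show "0 < \<gamma>" using eps M9 by (simp add: \<gamma>_def)
        have "1 / \<gamma> = 8 * real M * z" using eps by (simp add: \<gamma>_def z_def)
        also have "\<dots> \<le> z * z" using z by (intro mult_right_mono) auto
        finally show "1 / \<gamma> \<le> z\<^sup>2" by (simp add: power2_eq_square)
        have "\<gamma> \<le> 1 / 1" unfolding \<gamma>_def using eps_half M9 eps by (intro frac_le) auto
        then show "\<gamma> \<le> 1" by simp
      qed
      have \<gamma>M: "1 / \<gamma> ^ M \<le> z ^ (2 * M)"
      proof -
        have "(1 / \<gamma>) ^ M \<le> (z\<^sup>2) ^ M" using \<gamma> by (intro power_mono) auto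
        then show ?thesis by (simp add: power_one_over power_mult)
      qed
      have four: "4 / \<gamma> ^ M \<le> real S"
      proof -
        have "4 / \<gamma> ^ M = 4 * (1 / \<gamma> ^ M)" by simp
        also have "\<dots> \<le> z * z ^ (2 * M)" using \<gamma>M z M9 \<gamma> by (intro mult_mono) auto
        also have "\<dots> \<le> z ^ (2 * M + 2)" using zpow[of "2 * M + 1" "2 * M + 2"] by simp
        finally show ?thesis using Sz by linarith
      qed
      have \<mu>0: "\<mu> > 0" using \<gamma> M9 by (simp add: \<mu>_def)
      have \<mu>S: "2 * \<mu> \<le> real S"
      proof -
        have "2 * \<mu> = (8 * real M) * (1 / \<gamma> ^ M)" by (simp add: \<mu>_def)
        also have "\<dots> \<le> z * z ^ (2 * M)" using \<gamma>M z M9 \<gamma> by (intro mult_mono) auto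
        also have "\<dots> \<le> z ^ (2 * M + 2)" using zpow[of "2 * M + 1" "2 * M + 2"] by simp
        finally show ?thesis using Sz by linarith
      qed
      show ?thesis
      proof (cases "n < k")
        \<comment> \<open>An initial equipartition with \<open>k\<close> parts needs at least
          \<open>k\<close> vertices; below that, n < k <= S.\<close>
        case True
        then have "real n ^ h \<le> real S ^ h" using k(4) by (intro power_mono) auto
        also have "\<dots> \<le> real S ^ (2 * M + 3)" by (rule Spow) (use hM in auto)
        finally show ?thesis by (rule small)
      next
        case nk: False
        have Vne: "V \<noteq> {}" using nk k(1) by (auto simp: n_def)
        obtain E1 where E1: "E1 \<subseteq> E" "real (card E1) \<ge> eps * (real (card V))\<^sup>2"
          and hit: "\<And>F. finite F \<Longrightarrow> card EH * card F < card E1 \<Longrightarrow>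
            \<exists>f \<in> VH \<rightarrow>\<^sub>E V. inj_on f VH \<and> (\<forall>e\<in>EH. f ` e \<in> E1 - F)"
          using packing[OF H(1) EH G far] by blast
        have sE1: "simple_graph V E1" by (rule simple_graph_subset[OF G E1(1)])
        have n0: "real (card V) > 0" using Vne fin by (simp add: card_gt_0_iff)
        have dens: "graph_density V E1 \<ge> eps"
        proof -
          have "eps * (real (card V))\<^sup>2 \<le> 2 * real (card E1)" using E1(2) by linarith
          then show ?thesis unfolding graph_density_def using n0 by (simp add: pos_le_divide_eq)
        qed
        \<comment> \<open>Starting from \<open>k\<close> parts forces the final partition to have at
          least \<open>k\<close>, so that few edges lie inside parts.\<close>
        obtain P0 where P0: "equipartition V P0" "card P0 = k"
          using equipartition_exists[OF fin(1), of k] nk k(1) by (auto simp: n_def)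
        have "real (card P0) \<le> 1 / \<eta>" using P0(2) k(2) by simp
        then obtain E' P where E': "simple_graph V E'" and diff: "real (card ((E1 - E') \<union> (E' - E1))) \<le> \<delta> * real (card E1)"
          and P: "regular_equipartition \<eta> V E' P" "refines P P0" "card P \<le> S"
          using S_reg_spec[OF \<eta>0 \<delta>0 sE1 dens P0(1)] unfolding S_def by metis
        have eq: "equipartition V P" using P by (simp add: regular_equipartition_def)
        have p: "partition_on V P" and p0: "partition_on V P0"
          using eq P0(1) by (simp_all add: equipartition_def)
        have fP: "finite P" using p fin finite_elements by blast
        have neP: "P \<noteq> {}" using partition_onD1[OF p] Vne by auto
        have kP: "k \<le> card P"
          using refinement_card[OF p0 p P(2) fP] P0(2) by simp
        have cP: "16 * real M / eps \<le> real (card P)"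
        proof -
          have "16 * real M / eps = 16 * real M * z" by (simp add: z_def)
          also have "\<dots> \<le> z * z" using z M9 by (intro mult_right_mono) auto
          also have "\<dots> \<le> z ^ (2 * M + 2)" using zpow[of 2 "2 * M + 2"] by (simp add: power2_eq_square)
          finally show ?thesis using k(3) kP by linarith
        qed
        have \<eta>1: "\<eta> \<le> eps / (32 * real M)"
        proof -
          have "32 * real M * z \<le> z * z" using z by (intro mult_right_mono) auto
          also have "\<dots> \<le> z ^ (2 * M + 3)" using zpow[of 2 "2 * M + 3"] by (simp add: power2_eq_square)
          finally have "1 / z ^ (2 * M + 3) \<le> 1 / (32 * real M * z)"
            using z M9 by (intro divide_left_mono) auto
          then show ?thesis unfolding \<eta>z z(4) by (simp add: mult.commute)
        qed
        have mH: "card EH \<le> M" using card_edges_le[OF H(1)] H(2) by (simp add: M_def)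
        have M0: "M > 0" using M9 by simp
        obtain X where X: "\<And>w. w \<in> VH \<Longrightarrow> X w \<in> P"
          "\<And>u v. {u, v} \<in> EH \<Longrightarrow> regular_pair \<eta> E' (X u) (X v) \<and> pair_density E' (X u) (X v) \<ge> eps / (8 * real M) \<and>
            real (edge_count (E' - E1) (X u) (X v)) \<le> 1 / (4 * real M) * real (edge_count E' (X u) (X v))"
          using reduced_embedding[OF H(1) mH M0 sE1 E' P(1) Vne eps(1) E1(2) diff[unfolded \<delta>_def] less_imp_le[OF \<eta>0] \<eta>1 cP hit]
          by blast
        define a where "a = Min (card ` P)"
        obtain A0 where A0: "A0 \<in> P" using neP by blast
        have a0: "a > 0" and nP: "n \<le> card P * (a + 1)"
          using equipartition_card_bounds[OF eq fin(1) neP A0] by (simp_all add: a_def n_def)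
        have aX: "a \<le> card (X w)" if "w \<in> VH" for w
          using equipartition_card_bounds(2)[OF eq fin(1) neP X(1)[OF that]] by (simp add: a_def)
        have "card P * (a + 1) \<le> S * (2 * a)" using P(3) a0 by (intro mult_mono) auto
        then have "n \<le> S * (2 * a)" using nP by linarith
        then have "real n \<le> real (S * (2 * a))" by (rule of_nat_mono)
        then have nSa: "real n \<le> 2 * real S * real a" by simp
        show ?thesis
        proof (cases "real a < \<mu>")
          \<comment> \<open>Small parts in a partition of order at most \<open>S\<close> mean a
            small graph: n <= 2 S \<mu> <= S^2.\<close>
          case True
          have "real n \<le> 2 * real S * \<mu>" using nSa True S1 mult_left_mono[of "real a" \<mu> "2 * real S"] by linarith
          also have "\<dots> = real S * (2 * \<mu>)" by simp
          also have "\<dots> \<le> real S * real S" using \<mu>S by (intro mult_left_mono) auto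
          finally have "real n ^ h \<le> (real S * real S) ^ h" by (intro power_mono) auto
          also have "\<dots> = real S ^ (2 * h)" by (simp add: power_mult_distrib mult_2 power_add)
          also have "\<dots> \<le> real S ^ (2 * M + 3)" by (rule Spow) (use hM in auto)
          finally show ?thesis by (rule small)
        next
          case a\<mu>: False
          have fX: "finite (X w)" "X w \<subseteq> V" if "w \<in> VH" for w
            using partition_on_finite_part[OF p fin(1) X(1)[OF that]] by blast+
          have MM: "real M + (real M)\<^sup>2 \<le> z * z"
          proof -
            have "real M * 1 \<le> real M * real M" using M9 by (intro mult_left_mono) auto
            then have "real M + (real M)\<^sup>2 \<le> 2 * real M * real M" by (simp add: power2_eq_square)
            also have "\<dots> \<le> z * z" using z(1) M9 by (intro mult_mono) auto
            finally show ?thesis .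
          qed
          \<comment> \<open>The exponent 2M+3 is spent here: 2M on \<gamma>^M, two on M + M^2 and
            one on the constant 4.\<close>
          have \<eta>2: "\<eta> * (real M + (real M)\<^sup>2) \<le> \<gamma> ^ M / 4"
          proof -
            have "4 * (real M + (real M)\<^sup>2) * (1 / \<gamma> ^ M) \<le> z * (z * z) * z ^ (2 * M)"
              using MM \<gamma>M z M9 \<gamma> by (intro mult_mono) auto
            also have "\<dots> = z ^ (2 * M + 3)" by (simp add: power_add power3_eq_cube mult_ac)
            finally have "4 * (real M + (real M)\<^sup>2) \<le> z ^ (2 * M + 3) * \<gamma> ^ M"
              using \<gamma> by (simp add: pos_divide_le_eq)
            moreover have "z ^ (2 * M + 3) > 0" using z by simp
            ultimately show ?thesis unfolding \<eta>z by (simp add: field_simps)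
          qed
          have "real (card {f \<in> PiE VH X. inj_on f VH \<and> (\<forall>e\<in>EH. f ` e \<in> E1)}) \<ge> \<gamma> ^ M / 4 * (\<Prod>w\<in>VH. real (card (X w)))"
          proof (rule embedding_count[OF H(1)])
            show "real M * (1 / (4 * real M)) \<le> 1 / 4" using M9 by simp
            show "\<mu> \<le> real (card (X w))" if "w \<in> VH" for w using a\<mu> aX[OF that] by linarith
            show "(real (card VH))\<^sup>2 / \<mu> \<le> \<gamma> ^ M / 4"
              using H(2) M9 \<gamma> by (simp add: \<mu>_def M_def)
          qed (use X(2) fX mH \<gamma> \<eta>0 \<eta>2 \<mu>0 M9 in \<open>auto simp: \<gamma>_def\<close>)
          moreover have "real (card {f \<in> PiE VH X. inj_on f VH \<and> (\<forall>e\<in>EH. f ` e \<in> E1)}) \<le> real N"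
          proof -
            have "PiE VH X \<subseteq> VH \<rightarrow>\<^sub>E V" by (rule PiE_mono) (use fX in auto)
            then have "{f \<in> PiE VH X. inj_on f VH \<and> (\<forall>e\<in>EH. f ` e \<in> E1)} \<subseteq>
                {f \<in> VH \<rightarrow>\<^sub>E V. inj_on f VH \<and> (\<forall>e\<in>EH. f ` e \<in> E)}" using E1(1) by blast
            then show ?thesis unfolding N_def copies_eq[OF H(1)]
              by (intro of_nat_mono card_mono finite_embeddings fin)
          qed
          moreover have "real a ^ h \<le> (\<Prod>w\<in>VH. real (card (X w)))"
          proof -
            have "real a ^ h = (\<Prod>w\<in>VH. real a)" using H(2) by simp
            also have "\<dots> \<le> (\<Prod>w\<in>VH. real (card (X w)))" using aX by (intro prod_mono) auto
            finally show ?thesis .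
          qed
          then have "\<gamma> ^ M / 4 * real a ^ h \<le> \<gamma> ^ M / 4 * (\<Prod>w\<in>VH. real (card (X w)))"
            using \<gamma> by (intro mult_left_mono) auto
          ultimately have "\<gamma> ^ M / 4 * real a ^ h \<le> real N" by linarith
          then have aN: "real a ^ h \<le> 4 / \<gamma> ^ M * real N"
            using \<gamma> by (simp add: field_simps)
          \<comment> \<open>Each factor \<open>n\<close> costs 2S <= S^2, and the constant 4 /
            \<gamma>^M costs one more \<open>S\<close>: 2h+1 factors in all.\<close>
          have "real n ^ h \<le> (2 * real S * real a) ^ h" using nSa by (intro power_mono) auto
          also have "\<dots> = (2 * real S) ^ h * real a ^ h" by (rule power_mult_distrib)
          also have "\<dots> \<le> (real S * real S) ^ h * (real S * real N)"
          proof (rule mult_mono)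
            have "2 * real S \<le> real S * real S" using S1 by (intro mult_right_mono) auto
            then show "(2 * real S) ^ h \<le> (real S * real S) ^ h" by (rule power_mono) simp
            have "4 / \<gamma> ^ M * real N \<le> real S * real N" using four by (intro mult_right_mono) auto
            then show "real a ^ h \<le> real S * real N" using aN by linarith
          qed auto
          also have "\<dots> = real S ^ (2 * h + 1) * real N"
            by (simp add: power_mult_distrib mult_2 power_add)
          also have "\<dots> \<le> real S ^ (2 * M + 3) * real N"
            by (intro mult_right_mono Spow) (use hM in auto)
          finally show ?thesis .
        qed
      qed
    qed
  qed
  then show ?thesis unfolding n_def N_def S_def \<eta>_def \<delta>_def .
qed

theorem theorem1p2:
  fixes h :: nat
  assumes "h \<ge> 3"
  shows "\<exists>eps0 delta0 C :: real. eps0 > 0 \<and> delta0 > 0 \<and> C > 0 \<and>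
    (\<forall>VH EH eps. simple_graph VH EH \<and> card VH = h \<and> 0 < eps \<and> eps \<le> eps0 \<longrightarrow>
       Rem VH EH eps \<le> real (S_reg (eps powr C) delta0 eps) powr C)"
proof -
  define M where "M = h\<^sup>2"
  have "3 * 3 \<le> h * h" using assms by (intro mult_mono) auto
  then have M9: "M \<ge> 9" by (simp add: M_def power2_eq_square)
  \<comment> \<open>One number for both roles of \<open>C\<close>: the exponent of the regularity
    parameter and the outer power.\<close>
  define c where "c = 2 * M + 3"
  define \<delta> where "\<delta> = 1 / (64 * (real M)\<^sup>2)"
  have main: "Rem VH EH eps \<le> real (S_reg (eps powr real c) \<delta> eps) powr real c"
    if H: "simple_graph VH EH" "card VH = h" and eps: "0 < eps" "eps \<le> 1 / (32 * real M)" for VH EH eps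
  proof -
    define S where "S = S_reg (eps ^ c) \<delta> eps"
    have "32 * real M \<ge> 2" using M9 by simp
    then have "1 / (32 * real M) \<le> 1 / 2" by (intro divide_left_mono) auto
    then have half: "eps \<le> 1 / 2" using eps by linarith
    have \<delta>0: "\<delta> \<ge> 0" by (simp add: \<delta>_def)
    obtain k :: nat where "k \<ge> 2" "k \<le> S_reg (eps ^ Suc (2 * M + 2)) \<delta> eps"
      using S_reg_lower[OF eps(1) half \<delta>0 half] .
    moreover have "Suc (2 * M + 2) = c" by (simp add: c_def)
    ultimately have "k \<ge> 2" "k \<le> S" unfolding S_def by (simp_all only:)
    then have S0: "S > 0" by linarith
    define R where "R = real S ^ c"
    have R0: "R > 0" using S0 by (simp add: R_def)
    have "Rem VH EH eps \<le> R"
      unfolding Rem_def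
    \<comment> \<open>To bound the infimum from above, one admissible \<open>R\<close> in a set
      bounded below is enough.\<close>
    proof (rule cInf_lower)
      show "bdd_below {R. 0 < R \<and> (\<forall>V E. simple_graph V E \<and>
          (\<forall>F\<subseteq>E. copies VH EH V (E - F) = 0 \<longrightarrow> eps * (real (card V))\<^sup>2 \<le> real (card F)) \<longrightarrow>
          real (card V) ^ card VH / R \<le> real (copies VH EH V E))}"
        by (rule bdd_belowI[of _ 0]) auto
      have "real (card V) ^ card VH / R \<le> real (copies VH EH V E)"
        if G: "simple_graph V E" and far: "\<forall>F\<subseteq>E. copies VH EH V (E - F) = 0 \<longrightarrow> eps * (real (card V))\<^sup>2 \<le> real (card F)"
        for V E
      proof -
        have "real (card V) ^ h \<le> R * real (copies VH EH V E)"
          using far_graph_copies[OF assms H eps[unfolded M_def] G far]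
          unfolding R_def S_def c_def \<delta>_def M_def .
        then show ?thesis using R0 H(2) by (simp add: pos_divide_le_eq mult.commute)
      qed
      then show "R \<in> {R. 0 < R \<and> (\<forall>V E. simple_graph V E \<and>
          (\<forall>F\<subseteq>E. copies VH EH V (E - F) = 0 \<longrightarrow> eps * (real (card V))\<^sup>2 \<le> real (card F)) \<longrightarrow>
          real (card V) ^ card VH / R \<le> real (copies VH EH V E))}"
        using R0 by blast
    qed
    \<comment> \<open>Real and natural powers agree because both bases are positive; for
      \<open>S\<close> this comes from \<open>S_reg_lower\<close>.\<close>
    also have "R = real (S_reg (eps powr real c) \<delta> eps) powr real c"
      using S0 eps(1) unfolding R_def S_def by (simp add: powr_realpow)
    finally show ?thesis .
  qed
  show ?thesis
  proof (intro exI conjI allI impI)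
    show "1 / (32 * real M) > 0" "\<delta> > 0" "real c > 0" using M9 by (auto simp: \<delta>_def c_def)
  qed (use main in auto)
qed

end
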